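(* Let $\mathcal A$ be a separable Banach algebra with $\Delta(\mathcal A)\neq\emptyset$, let $G$ be a locally compact Hausdorff group, and let $1<p<\infty$. Then $L^p(G,\mathcal A)$ is a Banach algebra under the convolution product if and only if $G$ is compact.
   Context: All algebras are over $\mathbb C$. $\Delta(\mathcal A)$ denotes the set of nonzero multiplicative linear functionals on $\mathcal A$. $\lambda$ is a left Haar measure on $G$, normalized so that $\lambda(G)=1$ when $G$ is compact. $L^p(G,\mathcal A)$ is the Banach space of (classes modulo $\lambda$-a.e. equality of) Borel measurable functions $f:G\to\mathcal A$ with $\|f\|_{p,\mathcal A}=\left(\int_G\|f(x)\|_{\mathcal A}^p\,d\lambda(x)\right)^{1/p}<\infty$. The convolution of $f,g:G\to\mathcal A$ is $(f*g)(x)=\int_G f(y)g(y^{-1}x)\,d\lambda(y)$ (Bochner integral), at each $x$ where this makes sense. "$L^p(G,\mathcal A)$ is a Banach algebra under convolution" means that for all $f,g\in L^p(G,\mathcal A)$, $f*g$ is defined $\lambda$-a.e., belongs to $L^p(G,\mathcal A)$, and $\|f*g\|_{p,\mathcal A}\le\|f\|_{p,\mathcal A}\|g\|_{p,\mathcal A}$. *)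

theory Defs
  imports "HOL-Analysis.Analysis"
begin

section \<open>Complex Banach algebras\<close>

text \<open>
  \<open>real_normed_algebra\<close> requires neither a unit nor commutativity, and contains
  submultiplicativity of the norm. The class below adds a complex scalar multiplication
  which extends the real one.
\<close>

class complex_banach_algebra = real_normed_algebra + banach +
  fixes scaleC :: "complex \<Rightarrow> 'a \<Rightarrow> 'a"
  assumes scaleC_add_right: "scaleC c (x + y) = scaleC c x + scaleC c y"
    and scaleC_add_left: "scaleC (c + d) x = scaleC c x + scaleC d x"
    and scaleC_scaleC: "scaleC c (scaleC d x) = scaleC (c * d) x"
    and scaleC_one: "scaleC 1 x = x"
    and scaleC_of_real: "scaleC (complex_of_real r) x = scaleR r x"
    and norm_scaleC: "norm (scaleC c x) = cmod c * norm x"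
    and mult_scaleC_left: "scaleC c x * y = scaleC c (x * y)"
    and mult_scaleC_right: "x * scaleC c y = scaleC c (x * y)"

class separable_complex_banach_algebra = complex_banach_algebra +
  assumes ex_countable_dense:
    "\<exists>D. countable D \<and> (\<forall>x. \<forall>e>0. \<exists>d\<in>D. dist d x < e)"

text \<open>The library's Bochner integral is defined for second countable Banach spaces.\<close>

instance separable_complex_banach_algebra \<subseteq> second_countable_topology
proof
  obtain D :: "'a set" where D: "countable D" "\<forall>x. \<forall>e>0. \<exists>d\<in>D. dist d x < e"
    using ex_countable_dense by blast
  define B where "B = (\<lambda>(d, q). ball d (real_of_rat q)) ` (D \<times> UNIV)"
  have "countable B"
    unfolding B_def using D(1) by (intro countable_image countable_SIGMA) auto
  moreover have "topological_basis B"
  proof (rule topological_basisI)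
    show "open b" if "b \<in> B" for b
      using that by (auto simp: B_def)
  next
    fix U :: "'a set" and x assume "open U" "x \<in> U"
    then obtain e where e: "e > 0" "ball x e \<subseteq> U"
      using openE by blast
    obtain q where q: "0 < real_of_rat q" "real_of_rat q < e / 2"
      using of_rat_dense[of 0 "e / 2"] e(1) by auto
    obtain d where d: "d \<in> D" "dist d x < real_of_rat q"
      using D(2) q(1) by blast
    have "ball d (real_of_rat q) \<subseteq> ball x e"
    proof
      fix y assume "y \<in> ball d (real_of_rat q)"
      then have "dist d y < real_of_rat q"
        by simp
      moreover have "dist x y \<le> dist d x + dist d y"
        by (metis dist_commute dist_triangle)
      ultimately show "y \<in> ball x e"
        using d(2) q(2) by simp
    qed
    moreover have "ball d (real_of_rat q) \<in> B"
      unfolding B_def using d(1) by (intro image_eqI[of _ _ "(d, q)"]) auto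
    moreover have "x \<in> ball d (real_of_rat q)"
      using d(2) by simp
    ultimately show "\<exists>b\<in>B. x \<in> b \<and> b \<subseteq> U"
      using e(2) by blast
  qed
  ultimately show "\<exists>B :: 'a set set. countable B \<and> open = generate_topology B"
    using topological_basis_imp_subbasis by blast
qed

definition characters :: "('a::complex_banach_algebra \<Rightarrow> complex) set" where
  "characters = {\<phi>. Vector_Spaces.linear scaleC (*) \<phi> \<and>
     (\<forall>x y. \<phi> (x * y) = \<phi> x * \<phi> y) \<and> \<phi> \<noteq> (\<lambda>_. 0)}"


section \<open>Haar measure\<close>

text \<open>
  A topological group is a type of class \<open>topological_group_add\<close>. That class does not
  include commutativity, so it covers all topological groups; only the notation is
  additive: \<open>x + y\<close> is the product, \<open>- x\<close> the inverse and \<open>0\<close> the identity.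
\<close>

text \<open>
  A left Haar measure is a nonzero left invariant Radon measure on the Borel sets, where
  Radon means finite on compact sets, outer regular on Borel sets and inner regular on
  open sets. It is normalized to total mass one when the group is compact.
\<close>

definition left_Haar_measure :: "'g::{topological_group_add, t2_space} measure \<Rightarrow> bool" where
  "left_Haar_measure \<mu> \<longleftrightarrow>
     sets \<mu> = sets borel \<and>
     emeasure \<mu> UNIV \<noteq> 0 \<and>
     (\<forall>K. compact K \<longrightarrow> emeasure \<mu> K < \<infinity>) \<and>
     (\<forall>B\<in>sets borel. emeasure \<mu> B = (INF U\<in>{U. open U \<and> B \<subseteq> U}. emeasure \<mu> U)) \<and>
     (\<forall>U. open U \<longrightarrow> emeasure \<mu> U = (SUP K\<in>{K. compact K \<and> K \<subseteq> U}. emeasure \<mu> K)) \<and>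
     (\<forall>x. \<forall>B\<in>sets borel. emeasure \<mu> ((+) x ` B) = emeasure \<mu> B)"

definition normalized_left_Haar_measure ::
    "'g::{topological_group_add, t2_space} measure \<Rightarrow> bool" where
  "normalized_left_Haar_measure \<mu> \<longleftrightarrow>
     left_Haar_measure \<mu> \<and> (compact (UNIV :: 'g set) \<longrightarrow> emeasure \<mu> UNIV = 1)"


section \<open>Vector-valued \<open>L\<^sup>p\<close> spaces and convolution\<close>

text \<open>
  Elements of \<open>L\<^sup>p\<close> are represented by functions instead of classes modulo equality almost
  everywhere.
\<close>

definition Lp_space :: "'g measure \<Rightarrow> real \<Rightarrow> ('g \<Rightarrow> 'a::real_normed_vector) set" where
  "Lp_space \<mu> p = {f \<in> borel_measurable \<mu>. (\<integral>\<^sup>+ x. ennreal (norm (f x) powr p) \<partial>\<mu>) < \<infinity>}"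

definition Lp_norm :: "'g measure \<Rightarrow> real \<Rightarrow> ('g \<Rightarrow> 'a::real_normed_vector) \<Rightarrow> real" where
  "Lp_norm \<mu> p f = (\<integral> x. norm (f x) powr p \<partial>\<mu>) powr (1 / p)"

text \<open>In multiplicative notation, \<open>- y + x\<close> is the product of the inverse of \<open>y\<close> with \<open>x\<close>.\<close>

definition convolution_defined_at ::
    "'g::topological_group_add measure \<Rightarrow> ('g \<Rightarrow> 'a::separable_complex_banach_algebra)
       \<Rightarrow> ('g \<Rightarrow> 'a) \<Rightarrow> 'g \<Rightarrow> bool" where
  "convolution_defined_at \<mu> f g x \<longleftrightarrow> integrable \<mu> (\<lambda>y. f y * g (- y + x))"

definition convolution ::
    "'g::topological_group_add measure \<Rightarrow> ('g \<Rightarrow> 'a::separable_complex_banach_algebra)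
       \<Rightarrow> ('g \<Rightarrow> 'a) \<Rightarrow> 'g \<Rightarrow> 'a" where
  "convolution \<mu> f g x = (\<integral> y. f y * g (- y + x) \<partial>\<mu>)"

text \<open>
  The convolution is only determined almost everywhere, so that it belongs to \<open>L\<^sup>p\<close> means
  that some \<open>h\<close> in \<open>L\<^sup>p\<close> agrees with it almost everywhere; the norm of the convolution is
  then the norm of \<open>h\<close>, which does not depend on the choice of \<open>h\<close>. The first argument
  only fixes the algebra.
\<close>

definition Lp_is_banach_algebra ::
    "'a::separable_complex_banach_algebra itself \<Rightarrow> 'g::topological_group_add measure
       \<Rightarrow> real \<Rightarrow> bool" where
  "Lp_is_banach_algebra _ \<mu> p \<longleftrightarrow>
     (\<forall>f \<in> (Lp_space \<mu> p :: ('g \<Rightarrow> 'a) set). \<forall>g \<in> Lp_space \<mu> p.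
        (AE x in \<mu>. convolution_defined_at \<mu> f g x) \<and>
        (\<exists>h \<in> Lp_space \<mu> p.
           (AE x in \<mu>. h x = convolution \<mu> f g x) \<and>
           Lp_norm \<mu> p h \<le> Lp_norm \<mu> p f * Lp_norm \<mu> p g))"

end

theory Submission
  imports Defs
begin

text \<open>
  Suppose that \<open>G\<close> is compact. By Jensen's inequality for the probability measure \<open>\<mu>\<close>,
  \<open>\<parallel>(f * g)(x)\<parallel>\<^sup>p \<le> \<integral> \<parallel>f(y)\<parallel>\<^sup>p \<parallel>g(y\<^sup>-\<^sup>1x)\<parallel>\<^sup>p dy\<close>, and one integrates over \<open>x\<close> by Fubini's theorem. Fubini's
  theorem needs \<open>(x, y) \<mapsto> g(y\<^sup>-\<^sup>1x)\<close> to be measurable for the product \<open>\<sigma>\<close>-algebra, which holds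
  after a modification of \<open>g\<close> on a null set: by outer regularity, compact \<open>G\<^sub>\<delta>\<close> sets generate all
  Borel sets up to null sets. As inversion preserves null sets, the convolution does not change.

  Conversely, choose \<open>a\<close> with \<open>a\<^sup>2 \<noteq> 0\<close>; the functions \<open>u a\<close> with \<open>u \<ge> 0\<close> show that
  \<open>\<parallel>u * v\<parallel>\<^sub>p \<le> C \<parallel>u\<parallel>\<^sub>p \<parallel>v\<parallel>\<^sub>p\<close> for the scalar convolution. If \<open>G\<close> is not compact, then \<open>\<mu>(G) = \<infinity>\<close> and
  there is a compact symmetric neighbourhood \<open>K\<close> of the identity with \<open>\<mu>(K)\<close> as large as needed.
  Since \<open>1\<^sub>K * 1\<^sub>K\<^sub>M \<ge> \<mu>(K)\<close> on \<open>M\<close>, the numbers \<open>\<mu>(K\<^sup>m)\<close> grow so fast that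
  \<open>f = (\<Sum>m\<le>N. \<mu>(K\<^sup>m)\<^sup>-\<^sup>1\<^sup>/\<^sup>p 1\<^bsub>K\<^sup>m\<^esub>)\<close> satisfies \<open>\<parallel>f\<parallel>\<^sub>p\<^sup>p \<le> 2\<^sup>p N\<close>. On the other hand \<open>f * f\<close> dominates the sum
  over \<open>j \<le> N\<close> of functions \<open>W\<^sub>j\<close> which live on \<open>K\<^sup>j\<close>, each of them made of about \<open>j\<close> terms of mass at
  least a multiple of \<open>\<mu>(K\<^sup>j)\<^sup>1\<^sup>-\<^sup>1\<^sup>/\<^sup>p\<close>. By Hoelder's inequality \<open>\<parallel>f * f\<parallel>\<^sub>p\<^sup>p\<close> is at least a multiple of
  \<open>\<Sum>j\<le>N. j\<^sup>p\<close>, hence of \<open>N\<^sup>p\<^sup>+\<^sup>1\<close>, while it is at most a multiple of \<open>N\<^sup>2\<close>.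
\<close>

section \<open>Jensen's inequality and left Haar measures\<close>

text \<open>The convex function \<open>v powr p\<close> lies above its tangent at the mean value
  \<open>t = I / measure M S\<close>, and this inequality is integrated over \<open>S\<close>. With
  \<open>S = UNIV\<close> it gives the upper bound on compact groups, with
  \<open>S = Q (Suc j)\<close> the lower bound for the pieces of \<open>f * f\<close>.\<close>

lemma powr_nn_integral_le:
  fixes u :: "'a \<Rightarrow> real"
  assumes p: "1 < p" and u[measurable]: "u \<in> borel_measurable M" and nonneg: "\<And>x. 0 \<le> u x"
    and S[measurable]: "S \<in> sets M" and S_fin: "emeasure M S < \<infinity>" and S_pos: "0 < measure M S"
    and supp: "\<And>x. x \<in> space M - S \<Longrightarrow> u x = 0"
    and I: "(\<integral>\<^sup>+x. ennreal (u x) \<partial>M) = ennreal I" "0 \<le> I"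
  shows "ennreal (measure M S powr (1 - p) * I powr p) \<le> (\<integral>\<^sup>+x. ennreal (u x powr p) \<partial>M)"
proof -
  define s where "s = measure M S"
  define t where "t = I / s"
  have s: "0 < s" using S_pos by (simp add: s_def)
  have t: "0 \<le> t" using I(2) s by (simp add: t_def)
  have It: "I = t * s" using s by (simp add: t_def)
  \<comment> \<open>Young's inequality with exponents \<open>p\<close> and
    \<open>p / (p - 1)\<close> for the product of \<open>v\<close> and
    \<open>t powr (p - 1)\<close>, multiplied by \<open>p\<close>.\<close>
  have tangent: "p * t powr (p - 1) * v \<le> v powr p + (p - 1) * t powr p" if "0 \<le> v" for v
  proof -
    have "v * t powr (p - 1) \<le> v powr p / p + (t powr (p - 1)) powr (p / (p - 1)) / (p / (p - 1))"
      using p that by (intro Youngs_inequality) (auto simp: field_simps)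
    also have "(t powr (p - 1)) powr (p / (p - 1)) = t powr p"
      using p by (simp add: powr_powr)
    finally have "p * (v * t powr (p - 1)) \<le> p * (v powr p / p + t powr p / (p / (p - 1)))"
      using p by (intro mult_left_mono) auto
    also have "\<dots> = v powr p + (p - 1) * t powr p"
      using p by (simp add: field_simps)
    finally show ?thesis by (simp add: ac_simps)
  qed
  have "ennreal (p * t powr p * s) = ennreal (p * t powr (p - 1)) * ennreal I"
    using p s t I by (cases "t = 0") (auto simp: It ennreal_mult' [symmetric] powr_diff field_simps)
  also have "\<dots> = (\<integral>\<^sup>+x. ennreal (p * t powr (p - 1)) * ennreal (u x) \<partial>M)"
    by (subst nn_integral_cmult) (auto simp: I)
  \<comment> \<open>Off \<open>S\<close> the left side vanishes, so the constant term of the tangent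
    inequality is charged only on \<open>S\<close>.\<close>
  also have "\<dots> \<le> (\<integral>\<^sup>+x. ennreal (u x powr p) + ennreal ((p - 1) * t powr p) * indicator S x \<partial>M)"
  proof (rule nn_integral_mono)
    fix x assume x: "x \<in> space M"
    show "ennreal (p * t powr (p - 1)) * ennreal (u x)
        \<le> ennreal (u x powr p) + ennreal ((p - 1) * t powr p) * indicator S x"
    proof (cases "x \<in> S")
      case True
      have "ennreal (p * t powr (p - 1)) * ennreal (u x) = ennreal (p * t powr (p - 1) * u x)"
        using p nonneg by (simp add: ennreal_mult')
      also have "\<dots> \<le> ennreal (u x powr p + (p - 1) * t powr p)"
        by (intro ennreal_leI tangent nonneg)
      also have "\<dots> = ennreal (u x powr p) + ennreal ((p - 1) * t powr p)"
        using p by (intro ennreal_plus) auto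
      finally show ?thesis using True by simp
    qed (use supp x in simp)
  qed
  also have "\<dots> = (\<integral>\<^sup>+x. ennreal (u x powr p) \<partial>M) + ennreal ((p - 1) * t powr p) * emeasure M S"
    by (simp add: nn_integral_add nn_integral_cmult_indicator del: nn_integral_indicator)
  also have "emeasure M S = ennreal s"
    using S_fin by (simp add: s_def emeasure_eq_ennreal_measure top.not_eq_extremum)
  finally have le: "ennreal (p * t powr p * s)
      \<le> (\<integral>\<^sup>+x. ennreal (u x powr p) \<partial>M) + ennreal ((p - 1) * t powr p * s)"
    using p s by (simp add: ennreal_mult')
  have eq: "measure M S powr (1 - p) * I powr p = t powr p * s"
    using s t by (simp add: s_def[symmetric] It powr_mult powr_diff field_simps)
  show ?thesis
  proof (cases "(\<integral>\<^sup>+x. ennreal (u x powr p) \<partial>M) = \<infinity>")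
    case False
    then obtain r where r: "(\<integral>\<^sup>+x. ennreal (u x powr p) \<partial>M) = ennreal r" "0 \<le> r"
      by (metis ennreal_cases infinity_ennreal_def)
    have "p * t powr p * s \<le> r + (p - 1) * t powr p * s"
      using le p s r by (simp add: ennreal_plus[symmetric] ennreal_le_iff del: ennreal_plus)
    then have "t powr p * s \<le> r"
      by (simp add: algebra_simps)
    then show ?thesis
      unfolding eq r by (rule ennreal_leI)
  qed simp
qed

lemma Hausdorff_euclidean: "Hausdorff_space (euclidean :: 'a::t2_space topology)"
  by (simp add: Hausdorff_space_def disjnt_def) (metis hausdorff)

lemma Lp_norm_eq:
  assumes [measurable]: "f \<in> borel_measurable M"
  shows "Lp_norm M p f = enn2real (\<integral>\<^sup>+x. ennreal (norm (f x) powr p) \<partial>M) powr (1 / p)"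
  unfolding Lp_norm_def by (subst integral_eq_nn_integral) auto

lemma diff_uminus_add [simp]: "x - (- y + x) = (y::'a::group_add)"
  by (metis add_minus_cancel eq_diff_eq)

lemma in_uminus_image_iff: "x \<in> uminus ` A \<longleftrightarrow> - x \<in> A" for x :: "'a::group_add"
  by (force simp: image_iff)

locale left_haar =
  fixes \<mu> :: "'g::{topological_group_add, t2_space} measure"
  assumes left_Haar: "left_Haar_measure \<mu>"
begin

lemma sets_eq_borel [simp, measurable_cong]: "sets \<mu> = sets borel"
  using left_Haar by (simp add: left_Haar_measure_def)

lemma space_eq_UNIV [simp]: "space \<mu> = UNIV"
  using sets_eq_imp_space_eq[OF sets_eq_borel] by simp

lemma emeasure_compact: "compact K \<Longrightarrow> emeasure \<mu> K < \<infinity>"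
  using left_Haar by (simp add: left_Haar_measure_def)

lemma outer_regular: "B \<in> sets borel \<Longrightarrow> emeasure \<mu> B = (INF U\<in>{U. open U \<and> B \<subseteq> U}. emeasure \<mu> U)"
  using left_Haar unfolding left_Haar_measure_def by blast

lemma inner_regular: "open U \<Longrightarrow> emeasure \<mu> U = (SUP K\<in>{K. compact K \<and> K \<subseteq> U}. emeasure \<mu> K)"
  using left_Haar unfolding left_Haar_measure_def by blast

lemma emeasure_translate: "B \<in> sets borel \<Longrightarrow> emeasure \<mu> ((+) x ` B) = emeasure \<mu> B"
  using left_Haar unfolding left_Haar_measure_def by blast

lemma borel_translate: "B \<in> sets borel \<Longrightarrow> (+) x ` B \<in> sets (borel :: 'g measure)"
proof -
  assume "B \<in> sets borel"
  moreover have "(\<lambda>y. - x + y) \<in> borel_measurable (borel :: 'g measure)"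
    by (intro borel_measurable_continuous_onI continuous_intros)
  ultimately have "(\<lambda>y. - x + y) -` B \<inter> space borel \<in> sets borel"
    by (rule measurable_sets[rotated])
  also have "(\<lambda>y. - x + y) -` B \<inter> space borel = (+) x ` B"
    by (auto simp: image_iff add.assoc[symmetric] intro!: bexI[of _ "- x + _"])
  finally show ?thesis .
qed

text \<open>Left invariance says that the image of \<open>\<mu>\<close> under a left translation is
  \<open>\<mu>\<close> again.\<close>

lemma nn_integral_translate:
  assumes [measurable]: "k \<in> borel_measurable borel"
  shows "(\<integral>\<^sup>+x. k (- y + x) \<partial>\<mu>) = (\<integral>\<^sup>+x. k x \<partial>\<mu>)"
proof -
  have [measurable]: "(\<lambda>x. - y + x) \<in> measurable \<mu> borel"
    by (simp add: measurable_cong_sets[OF sets_eq_borel refl])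
      (intro borel_measurable_continuous_onI continuous_intros)
  have "distr \<mu> borel (\<lambda>x. - y + x) = \<mu>"
  proof (rule measure_eqI)
    fix B assume "B \<in> sets (distr \<mu> borel (\<lambda>x. - y + x))"
    then have B: "B \<in> sets borel" by simp
    have "(\<lambda>x. - y + x) -` B = (+) y ` B"
      by (auto simp: image_iff add.assoc[symmetric] intro!: bexI[of _ "- y + _"])
    then show "emeasure (distr \<mu> borel (\<lambda>x. - y + x)) B = emeasure \<mu> B"
      using B by (simp add: emeasure_distr emeasure_translate)
  qed simp
  then have "(\<integral>\<^sup>+x. k x \<partial>\<mu>) = (\<integral>\<^sup>+x. k x \<partial>distr \<mu> borel (\<lambda>x. - y + x))"
    by simp
  also have "\<dots> = (\<integral>\<^sup>+x. k (- y + x) \<partial>\<mu>)"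
    by (subst nn_integral_distr) auto
  finally show ?thesis by simp
qed

lemma measurable_diff_left [measurable]: "(\<lambda>y. - y + x) \<in> borel_measurable (borel :: 'g measure)"
  by (intro borel_measurable_continuous_onI continuous_intros)

end

section \<open>Convolution on compact groups\<close>

locale compact_haar = left_haar \<mu> for \<mu> :: "'a::{topological_group_add, t2_space} measure" +
  assumes compact_UNIV: "compact (UNIV :: 'a set)" and emeasure_UNIV: "emeasure \<mu> UNIV = 1"
begin

sublocale finite_measure \<mu>
  by standard (simp add: emeasure_UNIV)

sublocale P: pair_sigma_finite \<mu> \<mu> ..

text \<open>
  On a non-metrizable group \<open>(x, y) \<mapsto> - y + x\<close> need not be measurable from the product of
  the Borel \<open>\<sigma>\<close>-algebras to the Borel \<open>\<sigma>\<close>-algebra.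
\<close>

definition prod_measurable_set :: "'a set \<Rightarrow> bool" where
  "prod_measurable_set B \<longleftrightarrow> B \<in> sets borel \<and> {z. - snd z + fst z \<in> B} \<in> sets (\<mu> \<Otimes>\<^sub>M \<mu>)"

lemma prod_measurable_set_borel: "prod_measurable_set B \<Longrightarrow> B \<in> sets borel"
  by (simp add: prod_measurable_set_def)

lemma prod_measurable_set_Compl:
  assumes "prod_measurable_set B" shows "prod_measurable_set (- B)"
proof -
  have "space (\<mu> \<Otimes>\<^sub>M \<mu>) - {z. - snd z + fst z \<in> B} \<in> sets (\<mu> \<Otimes>\<^sub>M \<mu>)"
    using assms by (intro sets.compl_sets) (simp add: prod_measurable_set_def)
  also have "space (\<mu> \<Otimes>\<^sub>M \<mu>) - {z. - snd z + fst z \<in> B} = {z. - snd z + fst z \<in> - B}"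
    by (auto simp: space_pair_measure)
  finally show ?thesis
    using assms by (simp add: prod_measurable_set_def borel_comp)
qed

lemma prod_measurable_set_UN:
  assumes "\<And>n::nat. prod_measurable_set (B n)" shows "prod_measurable_set (\<Union>n. B n)"
proof -
  have "(\<Union>n. {z. - snd z + fst z \<in> B n}) \<in> sets (\<mu> \<Otimes>\<^sub>M \<mu>)"
    using assms by (intro sets.countable_UN) (auto simp: prod_measurable_set_def)
  also have "(\<Union>n. {z. - snd z + fst z \<in> B n}) = {z. - snd z + fst z \<in> (\<Union>n. B n)}"
    by auto
  finally show ?thesis
    using assms by (auto simp: prod_measurable_set_def)
qed

lemma prod_measurable_set_INT:
  assumes "\<And>n::nat. prod_measurable_set (B n)" shows "prod_measurable_set (\<Inter>n. B n)"
  using prod_measurable_set_Compl[OF prod_measurable_set_UN[of "\<lambda>n. - B n"]]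
    prod_measurable_set_Compl[OF assms]
  by (simp add: Compl_UN)

text \<open>
  The preimage of a compact \<open>G\<^sub>\<delta>\<close> set is compact, so between it and each of the open sets in
  the intersection there is a finite union of open rectangles.
\<close>

lemma prod_measurable_set_compact_G_delta:
  assumes D: "closed D" and U: "\<And>n::nat. open (U n)" and D_eq: "D = (\<Inter>n. U n)"
  shows "prod_measurable_set D"
proof -
  have cont: "continuous_on UNIV (\<lambda>z::'a \<times> 'a. - snd z + fst z)"
    by (intro continuous_intros)
  define E where "E = {z::'a \<times> 'a. - snd z + fst z \<in> D}"
  have "closed E"
    using continuous_closed_preimage[OF cont closed_UNIV D] by (simp add: E_def vimage_def)
  moreover have "compact (UNIV :: ('a \<times> 'a) set)"
    using compact_Times[OF compact_UNIV compact_UNIV] by simp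
  ultimately have E: "compact E"
    using compact_Int_closed by fastforce
  have "\<exists>R\<in>sets (\<mu> \<Otimes>\<^sub>M \<mu>). E \<subseteq> R \<and> R \<subseteq> {z. - snd z + fst z \<in> U n}" for n
  proof -
    define Z where "Z = {z::'a \<times> 'a. - snd z + fst z \<in> U n}"
    have Z: "open Z"
      using continuous_open_preimage[OF cont open_UNIV U[of n]] by (simp add: Z_def vimage_def)
    define \<R> where "\<R> = {A \<times> B | A B. open A \<and> open B \<and> A \<times> B \<subseteq> Z}"
    have "E \<subseteq> \<Union>\<R>"
    proof
      fix z assume "z \<in> E"
      then have "z \<in> Z" by (auto simp: E_def Z_def D_eq)
      then obtain A B where "open A" "open B" "z \<in> A \<times> B" "A \<times> B \<subseteq> Z"
        using open_prod_elim[OF Z] by metis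
      then show "z \<in> \<Union>\<R>" by (auto simp: \<R>_def)
    qed
    moreover have "\<forall>R\<in>\<R>. open R"
      by (auto simp: \<R>_def open_Times)
    ultimately obtain \<F> where \<F>: "\<F> \<subseteq> \<R>" "finite \<F>" "E \<subseteq> \<Union>\<F>"
      using compactE[OF E] by metis
    have "\<Union>\<F> \<in> sets (\<mu> \<Otimes>\<^sub>M \<mu>)"
      using \<F>(1,2) by (intro sets.finite_Union) (auto simp: \<R>_def)
    moreover have "\<Union>\<F> \<subseteq> Z"
      using \<F>(1) by (auto simp: \<R>_def)
    ultimately show ?thesis
      using \<F>(3) by (auto simp: Z_def)
  qed
  then obtain R where R: "\<And>n. R n \<in> sets (\<mu> \<Otimes>\<^sub>M \<mu>)" "\<And>n. E \<subseteq> R n"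
      "\<And>n. R n \<subseteq> {z. - snd z + fst z \<in> U n}"
    by metis
  have "E = (\<Inter>n. R n)"
    using R(2,3) by (fastforce simp: E_def D_eq)
  moreover have "(\<Inter>n. R n) \<in> sets (\<mu> \<Otimes>\<^sub>M \<mu>)"
    using R(1) by (intro sets.countable_INT) auto
  ultimately show ?thesis
    using D by (auto simp: prod_measurable_set_def E_def)
qed

text \<open>A compact Hausdorff space is normal, so some Urysohn function \<open>f\<close> is 0 on
  \<open>C\<close> and 1 outside \<open>U\<close>. The closed set where \<open>f \<le> 0\<close> is
  the intersection of the open sets \<open>f < 1 / (n + 1)\<close>.\<close>

lemma prod_measurable_set_between:
  assumes "closed C" "open U" "C \<subseteq> U"
  obtains D where "prod_measurable_set D" "C \<subseteq> D" "D \<subseteq> U"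
proof -
  have "normal_space (euclidean :: 'a topology)"
    by (intro compact_Hausdorff_or_regular_imp_normal_space)
      (auto simp: compact_space_def compact_UNIV Hausdorff_euclidean)
  moreover have "closedin euclidean C" "closedin euclidean (- U)"
    using assms by (auto simp: closed_closedin[symmetric])
  moreover have "disjnt C (- U)"
    using assms by (auto simp: disjnt_def)
  ultimately obtain f where f: "continuous_map euclidean euclideanreal f" "f ` C \<subseteq> {0}" "f ` (- U) \<subseteq> {1}"
    by (rule Urysohn_lemma_alt)
  have cont: "continuous_on UNIV f"
    using f(1) by simp
  define D where "D = {x. f x \<le> 0}"
  have "prod_measurable_set D"
  proof (rule prod_measurable_set_compact_G_delta)
    show "closed D"
      unfolding D_def using cont by (intro closed_Collect_le continuous_intros)
    show "open {x. f x < 1 / real (Suc n)}" for n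
      using cont by (intro open_Collect_less continuous_intros)
    show "D = (\<Inter>n. {x. f x < 1 / real (Suc n)})"
    proof (intro equalityI subsetI)
      fix x assume "x \<in> (\<Inter>n. {x. f x < 1 / real (Suc n)})"
      then have "f x < 1 / real (Suc n)" for n by auto
      then show "x \<in> D"
        unfolding D_def using nat_approx_posE[of "f x"] by (metis leI less_asym mem_Collect_eq)
    qed (auto simp: D_def intro: le_less_trans)
  qed
  moreover have "C \<subseteq> D" "D \<subseteq> U"
    using f(2,3) by (force simp: D_def)+
  ultimately show ?thesis by (rule that)
qed

section \<open>Inversion and Haar measure on a compact group\<close>

lemma borel_uminus: "B \<in> sets borel \<Longrightarrow> uminus ` B \<in> sets (borel :: 'a measure)"
proof -
  assume "B \<in> sets borel"
  moreover have "uminus \<in> borel_measurable (borel :: 'a measure)"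
    by (intro borel_measurable_continuous_onI continuous_intros)
  ultimately have "uminus -` B \<inter> space borel \<in> sets (borel :: 'a measure)"
    by (rule measurable_sets[rotated])
  also have "uminus -` B \<inter> space borel = uminus ` B"
    by (auto simp: image_iff intro!: bexI[of _ "- _"])
  finally show ?thesis .
qed

text \<open>The indicator of \<open>- y + x \<in> B\<close> is integrated in both orders. The
  integral over \<open>x\<close> is the measure of \<open>B\<close>; the integral over
  \<open>y\<close> is that of a left translate of the reflection of \<open>B\<close>. Both are
  constant and the total mass is 1.\<close>

lemma emeasure_uminus_prod_measurable_set:
  assumes B: "prod_measurable_set B"
  shows "emeasure \<mu> (uminus ` B) = emeasure \<mu> B"
proof -
  have [measurable]: "B \<in> sets borel" "{z. - snd z + fst z \<in> B} \<in> sets (\<mu> \<Otimes>\<^sub>M \<mu>)"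
    using B by (auto simp: prod_measurable_set_def)
  have "(\<lambda>z. indicator {z. - snd z + fst z \<in> B} z :: ennreal) \<in> borel_measurable (\<mu> \<Otimes>\<^sub>M \<mu>)"
    by measurable
  then have "(\<lambda>(x, y). indicator B (- y + x) :: ennreal) \<in> borel_measurable (\<mu> \<Otimes>\<^sub>M \<mu>)"
    by (simp add: indicator_def case_prod_beta)
  then have "(\<integral>\<^sup>+y. (\<integral>\<^sup>+x. indicator B (- y + x) \<partial>\<mu>) \<partial>\<mu>) = (\<integral>\<^sup>+x. (\<integral>\<^sup>+y. indicator B (- y + x) \<partial>\<mu>) \<partial>\<mu>)"
    by (rule P.Fubini')
  moreover have "(\<integral>\<^sup>+x. indicator B (- y + x) \<partial>\<mu>) = emeasure \<mu> B" for y
    by (subst nn_integral_translate) auto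
  moreover have "(\<integral>\<^sup>+y. indicator B (- y + x) \<partial>\<mu>) = emeasure \<mu> (uminus ` B)" for x
  proof -
    have "indicator B (- y + x) = (indicator ((+) x ` uminus ` B) y :: ennreal)" for y
    proof -
      have "- y + x \<in> B \<longleftrightarrow> y \<in> (+) x ` uminus ` B"
        by (auto simp: image_iff intro!: bexI[of _ "- y + x"])
      then show ?thesis by (simp add: indicator_def)
    qed
    then show ?thesis
      by (simp add: borel_translate borel_uminus emeasure_translate)
  qed
  ultimately show ?thesis
    by (simp add: emeasure_UNIV)
qed

text \<open>By outer regularity it suffices to compare with open \<open>U\<close> containing
  \<open>C\<close>, and a set \<open>D\<close> between \<open>C\<close> and \<open>U\<close> is
  already known to keep its measure under inversion.\<close>

lemma emeasure_uminus_closed_le: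
  assumes "closed C" shows "emeasure \<mu> (uminus ` C) \<le> emeasure \<mu> C"
proof -
  have C: "C \<in> sets borel" using assms by simp
  have "emeasure \<mu> (uminus ` C) \<le> emeasure \<mu> U" if U: "open U" "C \<subseteq> U" for U
  proof -
    obtain D where D: "prod_measurable_set D" "C \<subseteq> D" "D \<subseteq> U"
      using prod_measurable_set_between[OF assms U] .
    have "emeasure \<mu> (uminus ` C) \<le> emeasure \<mu> (uminus ` D)"
      using D borel_uminus[OF prod_measurable_set_borel[OF D(1)]] by (intro emeasure_mono) auto
    also have "\<dots> \<le> emeasure \<mu> U"
      using D U by (subst emeasure_uminus_prod_measurable_set) (auto intro!: emeasure_mono)
    finally show ?thesis .
  qed
  then show ?thesis
    by (subst outer_regular[OF C]) (auto intro: INF_greatest)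
qed

lemma emeasure_uminus_closed:
  assumes "closed C" shows "emeasure \<mu> (uminus ` C) = emeasure \<mu> C"
proof (rule antisym)
  have "closed (uminus -` C)"
    using assms by (intro closed_vimage continuous_intros)
  also have "uminus -` C = uminus ` C"
    by (auto simp: image_iff intro!: bexI[of _ "- _"])
  finally have "emeasure \<mu> (uminus ` uminus ` C) \<le> emeasure \<mu> (uminus ` C)"
    by (rule emeasure_uminus_closed_le)
  then show "emeasure \<mu> C \<le> emeasure \<mu> (uminus ` C)"
    by (simp add: image_image)
qed (rule emeasure_uminus_closed_le[OF assms])

lemma emeasure_uminus_open:
  assumes "open U" shows "emeasure \<mu> (uminus ` U) = emeasure \<mu> U"
proof -
  have "uminus ` U = UNIV - uminus ` (- U)"
    by (auto simp: in_uminus_image_iff)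
  moreover have "emeasure \<mu> (UNIV - uminus ` (- U)) = emeasure \<mu> UNIV - emeasure \<mu> (uminus ` (- U))"
    using assms borel_uminus[of "- U"] by (intro emeasure_Diff) auto
  moreover have "emeasure \<mu> (uminus ` (- U)) = emeasure \<mu> (- U)"
    using assms by (intro emeasure_uminus_closed) auto
  moreover have "emeasure \<mu> (UNIV - (- U)) = emeasure \<mu> UNIV - emeasure \<mu> (- U)"
    using assms by (intro emeasure_Diff) auto
  ultimately show ?thesis
    by (simp add: Compl_eq_Diff_UNIV Diff_Diff_Int)
qed

text \<open>Outer regularity reduces this to open sets, which keep their measure under
  inversion.\<close>

lemma null_uminus:
  assumes "N \<in> null_sets \<mu>" shows "uminus ` N \<in> null_sets \<mu>"
proof -
  have N: "N \<in> sets borel" "emeasure \<mu> N = 0"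
    using assms by auto
  have "emeasure \<mu> (uminus ` N) \<le> emeasure \<mu> U" if "open U" "N \<subseteq> U" for U
  proof -
    have "emeasure \<mu> (uminus ` N) \<le> emeasure \<mu> (uminus ` U)"
      using that borel_uminus[of U] by (intro emeasure_mono) auto
    then show ?thesis
      using that by (simp add: emeasure_uminus_open)
  qed
  then have "emeasure \<mu> (uminus ` N) \<le> emeasure \<mu> N"
    by (subst outer_regular[OF N(1)]) (auto intro: INF_greatest)
  then show ?thesis
    using N borel_uminus by (auto simp: null_sets_def)
qed

text \<open>The new exceptional set lies in a left translate of the reflection of the old one. Hence
  a modification of \<open>g\<close> on a null set changes the convolution integrand only on a null
  set, for every single \<open>x\<close>.\<close>

lemma AE_diff_left:
  assumes "AE y in \<mu>. Q y" shows "AE y in \<mu>. Q (- y + x)"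
proof -
  obtain N where N: "{y. \<not> Q y} \<subseteq> N" "N \<in> null_sets \<mu>"
    using assms by (auto elim!: AE_E simp: null_sets_def)
  have "emeasure \<mu> ((+) x ` uminus ` N) = 0"
    using null_uminus[OF N(2)] by (subst emeasure_translate) auto
  moreover have "(+) x ` uminus ` N \<in> sets borel"
    using N(2) by (intro borel_translate borel_uminus) auto
  ultimately have "(+) x ` uminus ` N \<in> null_sets \<mu>"
    by auto
  moreover have "{y \<in> space \<mu>. \<not> Q (- y + x)} \<subseteq> (+) x ` uminus ` N"
  proof
    fix y assume "y \<in> {y \<in> space \<mu>. \<not> Q (- y + x)}"
    then have "- y + x \<in> N" using N(1) by auto
    then show "y \<in> (+) x ` uminus ` N"
      by (auto simp: image_iff intro!: bexI[of _ "- y + x"])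
  qed
  ultimately show ?thesis
    by (rule AE_I')
qed

text \<open>The Borel sets are generated by the closed sets. A closed \<open>C\<close> has open
  neighbourhoods \<open>U n\<close> of nearly the same measure; squeezing a \<open>D n\<close>
  between \<open>C\<close> and each \<open>U n\<close> gives an intersection that exceeds
  \<open>C\<close> by a null set.\<close>

lemma AE_eq_prod_measurable_set:
  assumes "B \<in> sets borel"
  shows "\<exists>D. prod_measurable_set D \<and> (AE x in \<mu>. x \<in> B \<longleftrightarrow> x \<in> D)"
proof -
  have "B \<in> sigma_sets UNIV {C. closed C}"
    using assms by (simp add: borel_eq_closed)
  then show ?thesis
  proof (induction rule: sigma_sets.induct)
    case (Basic C)
    then have C: "closed C" by simp
    have "\<exists>U. open U \<and> C \<subseteq> U \<and> emeasure \<mu> U < emeasure \<mu> C + ennreal (1 / real (Suc n))" for n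
    proof -
      have "(INF U\<in>{U. open U \<and> C \<subseteq> U}. emeasure \<mu> U) = emeasure \<mu> C"
        using outer_regular[of C] C by simp
      also have "\<dots> < emeasure \<mu> C + ennreal (1 / real (Suc n))"
        by (simp add: ennreal_add_left_cancel_less[of _ 0, simplified] emeasure_finite)
      finally show ?thesis
        by (auto simp: INF_less_iff)
    qed
    then obtain U where U: "\<And>n. open (U n)" "\<And>n. C \<subseteq> U n"
        "\<And>n. emeasure \<mu> (U n) < emeasure \<mu> C + ennreal (1 / real (Suc n))"
      by metis
    have "\<exists>D. prod_measurable_set D \<and> C \<subseteq> D \<and> D \<subseteq> U n" for n
      by (rule prod_measurable_set_between[OF C U(1,2)]) blast
    then obtain D where D: "\<And>n. prod_measurable_set (D n)" "\<And>n. C \<subseteq> D n" "\<And>n. D n \<subseteq> U n"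
      by metis
    define D' where "D' = (\<Inter>n. D n)"
    have D': "prod_measurable_set D'"
      unfolding D'_def using D(1) by (rule prod_measurable_set_INT)
    have "emeasure \<mu> D' \<le> emeasure \<mu> C"
    proof (rule ennreal_le_epsilon)
      fix e :: real assume "0 < e"
      then obtain n where n: "1 / real (Suc n) < e"
        using nat_approx_posE by blast
      have "D' \<subseteq> U n"
        using D(3)[of n] by (auto simp: D'_def)
      then have "emeasure \<mu> D' \<le> emeasure \<mu> (U n)"
        using U(1) by (intro emeasure_mono) auto
      also have "\<dots> \<le> emeasure \<mu> C + ennreal (1 / real (Suc n))"
        using U(3) less_imp_le by blast
      also have "\<dots> \<le> emeasure \<mu> C + ennreal e"
        using n by (intro add_left_mono ennreal_leI) auto
      finally show "emeasure \<mu> D' \<le> emeasure \<mu> C + ennreal e" .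
    qed
    moreover have "C \<subseteq> D'" using D(2) by (auto simp: D'_def)
    ultimately have "emeasure \<mu> (D' - C) = 0"
      using C prod_measurable_set_borel[OF D']
      by (subst emeasure_Diff) (auto simp: diff_eq_0_iff_ennreal top.not_eq_extremum less_top[symmetric])
    then have "D' - C \<in> null_sets \<mu>"
      using C prod_measurable_set_borel[OF D'] by auto
    then have "AE x in \<mu>. x \<notin> D' - C"
      by (rule AE_not_in)
    then show ?case
      using D' \<open>C \<subseteq> D'\<close> by (intro exI[of _ D']) (auto elim: eventually_mono)
  next
    case Empty
    have "prod_measurable_set {}"
      by (auto simp: prod_measurable_set_def)
    then show ?case by (intro exI[of _ "{}"]) auto
  next
    case (Compl B)
    then obtain D where "prod_measurable_set D" "AE x in \<mu>. x \<in> B \<longleftrightarrow> x \<in> D"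
      by blast
    then show ?case
      by (intro exI[of _ "- D"]) (auto intro: prod_measurable_set_Compl)
  next
    case (Union B)
    then obtain D where D: "\<And>n. prod_measurable_set (D n)" "\<And>n. AE x in \<mu>. x \<in> B n \<longleftrightarrow> x \<in> D n"
      by metis
    have "AE x in \<mu>. \<forall>n. x \<in> B n \<longleftrightarrow> x \<in> D n"
      using D(2) by (simp add: AE_all_countable)
    then have "AE x in \<mu>. x \<in> (\<Union>n. B n) \<longleftrightarrow> x \<in> (\<Union>n. D n)"
      by eventually_elim auto
    then show ?case
      using prod_measurable_set_UN[of D] D(1) by blast
  qed
qed

text \<open>The function is a limit of simple functions \<open>F i\<close>, each with finitely many
  level sets. Replacing these level sets by the sets \<open>D i v\<close> changes all the
  \<open>F i\<close> only on one common null set.\<close>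

lemma AE_eq_prod_measurable:
  fixes g :: "'a \<Rightarrow> 'b::{banach, second_countable_topology}"
  assumes "g \<in> borel_measurable borel"
  obtains g' where "g' \<in> borel_measurable borel"
    "(\<lambda>z. g' (- snd z + fst z)) \<in> borel_measurable (\<mu> \<Otimes>\<^sub>M \<mu>)" "AE x in \<mu>. g x = g' x"
proof -
  have "g \<in> borel_measurable \<mu>"
    using assms by simp
  then obtain F where F: "\<And>i. simple_function \<mu> (F i)" "\<And>x. (\<lambda>i. F i x) \<longlonglongrightarrow> g x"
    using borel_measurable_implies_sequence_metric[of g \<mu> 0] by auto
  have "F i -` {v} \<in> sets borel" for i v
    using simple_functionD(2)[OF F(1)[of i], of "{v}"] by simp
  then have "\<exists>D. prod_measurable_set D \<and> (AE x in \<mu>. F i x = v \<longleftrightarrow> x \<in> D)" for i v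
    using AE_eq_prod_measurable_set[of "F i -` {v}"] by auto
  then obtain D where D: "\<And>i v. prod_measurable_set (D i v)"
      "\<And>i v. AE x in \<mu>. F i x = v \<longleftrightarrow> x \<in> D i v"
    by metis
  have fin: "finite (range (F i))" for i
    using simple_functionD(1)[OF F(1)[of i]] by simp
  define G where "G i x = (\<Sum>v\<in>range (F i). indicat_real (D i v) x *\<^sub>R v)" for i x
  have [measurable]: "D i v \<in> sets borel" "{z. - snd z + fst z \<in> D i v} \<in> sets (\<mu> \<Otimes>\<^sub>M \<mu>)" for i v
    using D(1)[of i v] by (auto simp: prod_measurable_set_def)
  have G_borel: "G i \<in> borel_measurable borel" for i
    unfolding G_def by measurable
  have G_prod: "(\<lambda>z. G i (- snd z + fst z)) \<in> borel_measurable (\<mu> \<Otimes>\<^sub>M \<mu>)" for i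
  proof -
    have "(\<lambda>z. G i (- snd z + fst z)) =
        (\<lambda>z. \<Sum>v\<in>range (F i). indicat_real {z. - snd z + fst z \<in> D i v} z *\<^sub>R v)"
      by (simp add: G_def indicator_def)
    also have "\<dots> \<in> borel_measurable (\<mu> \<Otimes>\<^sub>M \<mu>)"
      by measurable
    finally show ?thesis .
  qed
  have eq: "AE x in \<mu>. F i x = G i x" for i
  proof -
    have "AE x in \<mu>. \<forall>v\<in>range (F i). F i x = v \<longleftrightarrow> x \<in> D i v"
      using fin D(2) by (intro AE_finite_allI) auto
    then show ?thesis
    proof eventually_elim
      case (elim x)
      have "G i x = (\<Sum>v\<in>range (F i). if v = F i x then v else 0)"
        unfolding G_def using elim by (intro sum.cong) (auto simp: indicator_def, metis)
      then show ?case using fin by simp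
    qed
  qed
  show ?thesis
  \<comment> \<open>\<open>lim\<close> has an unspecified value where the sequence diverges; this
    can happen only on a null set, and measurability is not affected.\<close>
  proof (rule that[of "\<lambda>x. lim (\<lambda>i. G i x)"])
    show "(\<lambda>x. lim (\<lambda>i. G i x)) \<in> borel_measurable borel"
      using G_borel by measurable
    show "(\<lambda>z. lim (\<lambda>i. G i (- snd z + fst z))) \<in> borel_measurable (\<mu> \<Otimes>\<^sub>M \<mu>)"
      using G_prod by (rule borel_measurable_lim_metric)
    have "AE x in \<mu>. \<forall>i. F i x = G i x"
      using eq by (simp add: AE_all_countable)
    then show "AE x in \<mu>. g x = lim (\<lambda>i. G i x)"
    proof eventually_elim
      case (elim x)
      then show ?case using limI[OF F(2)[of x]] by simp
    qed
  qed
qed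

section \<open>The convolution inequality on a compact group\<close>

lemma Lp_is_banach_algebra:
  assumes p: "1 < p"
  shows "Lp_is_banach_algebra TYPE('b::separable_complex_banach_algebra) \<mu> p"
  unfolding Lp_is_banach_algebra_def
proof (intro ballI conjI)
  fix f g :: "'a \<Rightarrow> 'b"
  assume "f \<in> Lp_space \<mu> p" "g \<in> Lp_space \<mu> p"
  then have f[measurable]: "f \<in> borel_measurable borel" and g[measurable]: "g \<in> borel_measurable borel"
    and f_fin: "(\<integral>\<^sup>+x. ennreal (norm (f x) powr p) \<partial>\<mu>) < \<infinity>"
    and g_fin: "(\<integral>\<^sup>+x. ennreal (norm (g x) powr p) \<partial>\<mu>) < \<infinity>"
    by (auto simp: Lp_space_def)
  obtain g' where g'[measurable]: "g' \<in> borel_measurable borel"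
    and g'_prod[measurable]: "(\<lambda>z. g' (- snd z + fst z)) \<in> borel_measurable (\<mu> \<Otimes>\<^sub>M \<mu>)"
    and g'_eq: "AE x in \<mu>. g x = g' x"
    using AE_eq_prod_measurable[OF g] .
  have g'_eq_shift: "AE y in \<mu>. g (- y + x) = g' (- y + x)" for x
    by (rule AE_diff_left[OF g'_eq])
  define u where "u x y = norm (f y) * norm (g' (- y + x))" for x y
  \<comment> \<open>\<open>P\<close> dominates the p-th power of the norm of the convolution, and
    its integral is exactly the product of the p-th power integrals of \<open>f\<close> and
    \<open>g\<close>.\<close>
  define P where "P x = (\<integral>\<^sup>+y. ennreal (u x y powr p) \<partial>\<mu>)" for x
  define h where "h x = (\<integral>y. f y * g' (- y + x) \<partial>\<mu>)" for x
  have [measurable]: "(\<lambda>y. g' (- y + x)) \<in> borel_measurable borel"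
      "(\<lambda>y. g (- y + x)) \<in> borel_measurable borel" for x
    using measurable_compose[OF measurable_diff_left g'] measurable_compose[OF measurable_diff_left g]
    by simp_all
  have u_nonneg: "0 \<le> u x y" for x y
    by (simp add: u_def)
  have u_meas[measurable]: "u x \<in> borel_measurable \<mu>" for x
    unfolding u_def by measurable
  have u_prod[measurable]: "(\<lambda>z. u (fst z) (snd z)) \<in> borel_measurable (\<mu> \<Otimes>\<^sub>M \<mu>)"
    unfolding u_def by measurable
  have up: "(\<lambda>(x, y). ennreal (u x y powr p)) \<in> borel_measurable (\<mu> \<Otimes>\<^sub>M \<mu>)"
    unfolding case_prod_beta by measurable
  have P_meas[measurable]: "P \<in> borel_measurable \<mu>"
    unfolding P_def using borel_measurable_nn_integral[OF up] by simp
  have "(\<integral>\<^sup>+x. P x \<partial>\<mu>) = (\<integral>\<^sup>+y. (\<integral>\<^sup>+x. ennreal (u x y powr p) \<partial>\<mu>) \<partial>\<mu>)"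
    unfolding P_def by (rule P.Fubini'[symmetric, OF up])
  also have "\<dots> = (\<integral>\<^sup>+y. ennreal (norm (f y) powr p) * (\<integral>\<^sup>+x. ennreal (norm (g' x) powr p) \<partial>\<mu>) \<partial>\<mu>)"
  proof (rule nn_integral_cong)
    fix y
    have "(\<integral>\<^sup>+x. ennreal (u x y powr p) \<partial>\<mu>) =
        (\<integral>\<^sup>+x. ennreal (norm (f y) powr p) * ennreal (norm (g' (- y + x)) powr p) \<partial>\<mu>)"
      by (simp add: u_def powr_mult ennreal_mult')
    also have "\<dots> = (\<integral>\<^sup>+x. ennreal (norm (f y) powr p) * ennreal (norm (g' x) powr p) \<partial>\<mu>)"
      by (rule nn_integral_translate) measurable
    also have "\<dots> = ennreal (norm (f y) powr p) * (\<integral>\<^sup>+x. ennreal (norm (g' x) powr p) \<partial>\<mu>)"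
      by (rule nn_integral_cmult) measurable
    finally show "(\<integral>\<^sup>+x. ennreal (u x y powr p) \<partial>\<mu>) = \<dots>" .
  qed
  also have "\<dots> = (\<integral>\<^sup>+y. ennreal (norm (f y) powr p) \<partial>\<mu>) * (\<integral>\<^sup>+x. ennreal (norm (g' x) powr p) \<partial>\<mu>)"
    by (rule nn_integral_multc) measurable
  also have "(\<integral>\<^sup>+x. ennreal (norm (g' x) powr p) \<partial>\<mu>) = (\<integral>\<^sup>+x. ennreal (norm (g x) powr p) \<partial>\<mu>)"
    using g'_eq by (intro nn_integral_cong_AE) (auto elim: eventually_mono)
  finally have int_P: "(\<integral>\<^sup>+x. P x \<partial>\<mu>) =
      (\<integral>\<^sup>+x. ennreal (norm (f x) powr p) \<partial>\<mu>) * (\<integral>\<^sup>+x. ennreal (norm (g x) powr p) \<partial>\<mu>)" .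
  then have int_P_fin: "(\<integral>\<^sup>+x. P x \<partial>\<mu>) < \<infinity>"
    using f_fin g_fin by (simp add: ennreal_mult_less_top)
  \<comment> \<open>On a space of total mass 1, p-th power integrability implies integrability,
    because \<open>v \<le> 1 + v powr p\<close>.\<close>
  have int_u: "(\<integral>\<^sup>+y. ennreal (u x y) \<partial>\<mu>) < \<infinity>" if "P x < \<infinity>" for x
  proof -
    have le: "v \<le> 1 + v powr p" if "0 \<le> v" for v :: real
    proof (cases "v \<le> 1")
      case False
      then have "v powr 1 \<le> v powr p" using p by (intro powr_mono) auto
      then show ?thesis using False by simp
    qed (simp add: add_increasing2)
    have "(\<integral>\<^sup>+y. ennreal (u x y) \<partial>\<mu>) \<le> (\<integral>\<^sup>+y. 1 + ennreal (u x y powr p) \<partial>\<mu>)"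
      using ennreal_leI[OF le[OF u_nonneg]] by (intro nn_integral_mono) simp
    also have "\<dots> = 1 + P x"
      by (subst nn_integral_add) (auto simp: P_def emeasure_UNIV)
    finally show ?thesis using that by (auto simp: less_top[symmetric] top_unique)
  qed
  have integrable_shift: "integrable \<mu> (\<lambda>y. f y * g' (- y + x))" if "P x < \<infinity>" for x
  proof (rule integrableI_bounded)
    have "(\<integral>\<^sup>+y. ennreal (norm (f y * g' (- y + x))) \<partial>\<mu>) \<le> (\<integral>\<^sup>+y. ennreal (u x y) \<partial>\<mu>)"
      unfolding u_def by (intro nn_integral_mono ennreal_leI norm_mult_ineq)
    then show "(\<integral>\<^sup>+y. ennreal (norm (f y * g' (- y + x))) \<partial>\<mu>) < \<infinity>"
      using int_u[OF that] by (rule le_less_trans)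
  qed measurable
  have "AE x in \<mu>. P x \<noteq> \<infinity>"
    using int_P_fin by (intro nn_integral_PInf_AE) auto
  then show "AE x in \<mu>. convolution_defined_at \<mu> f g x"
  proof eventually_elim
    case (elim x)
    have "AE y in \<mu>. f y * g' (- y + x) = f y * g (- y + x)"
      using g'_eq_shift[of x] by eventually_elim simp
    moreover have "integrable \<mu> (\<lambda>y. f y * g' (- y + x))"
      using elim by (intro integrable_shift) (simp add: top.not_eq_extremum)
    ultimately show ?case
      unfolding convolution_defined_at_def by (subst integrable_cong_AE[symmetric]) auto
  qed
  \<comment> \<open>The two integrands agree almost everywhere for each \<open>x\<close>, so the
    convolution is the same at every point, not only almost everywhere.\<close>
  have h_eq: "convolution \<mu> f g x = h x" for x
    unfolding convolution_def h_def
    using g'_eq_shift[of x] by (intro integral_cong_AE) (auto elim: eventually_mono)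
  have h_meas[measurable]: "h \<in> borel_measurable \<mu>"
    unfolding h_def by (rule borel_measurable_lebesgue_integral) (unfold case_prod_beta, measurable)
  have h_le: "ennreal (norm (h x) powr p) \<le> P x" for x
  proof (cases "P x = \<infinity>")
    case False
    then have Px: "P x < \<infinity>" by (simp add: top.not_eq_extremum)
    obtain I where I: "(\<integral>\<^sup>+y. ennreal (u x y) \<partial>\<mu>) = ennreal I" "0 \<le> I"
      using int_u[OF Px] by (cases "\<integral>\<^sup>+y. ennreal (u x y) \<partial>\<mu>") auto
    have "ennreal (norm (h x)) \<le> (\<integral>\<^sup>+y. ennreal (norm (f y * g' (- y + x))) \<partial>\<mu>)"
      unfolding h_def by (rule integral_norm_bound_ennreal[OF integrable_shift[OF Px]])
    also have "\<dots> \<le> ennreal I"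
      unfolding I(1)[symmetric] u_def by (intro nn_integral_mono ennreal_leI norm_mult_ineq)
    finally have "norm (h x) \<le> I" using I(2) by simp
    \<comment> \<open>The factor \<open>measure \<mu> UNIV powr (1 - p)\<close> equals 1; it is
      inserted to match Jensen's inequality.\<close>
    then have "ennreal (norm (h x) powr p) \<le> ennreal (measure \<mu> UNIV powr (1 - p) * I powr p)"
      using p by (intro ennreal_leI) (simp add: measure_def emeasure_UNIV powr_mono2)
    also have "\<dots> \<le> P x"
      unfolding P_def using I
      by (intro powr_nn_integral_le[OF p u_meas u_nonneg]) (auto simp: measure_def emeasure_UNIV)
    finally show ?thesis .
  qed simp
  have int_h: "(\<integral>\<^sup>+x. ennreal (norm (h x) powr p) \<partial>\<mu>) \<le> (\<integral>\<^sup>+x. P x \<partial>\<mu>)"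
    by (intro nn_integral_mono h_le)
  show "\<exists>h\<in>Lp_space \<mu> p. (AE x in \<mu>. h x = convolution \<mu> f g x) \<and>
      Lp_norm \<mu> p h \<le> Lp_norm \<mu> p f * Lp_norm \<mu> p g"
  proof (intro bexI[of _ h] conjI)
    show "h \<in> Lp_space \<mu> p"
      unfolding Lp_space_def using h_meas le_less_trans[OF int_h int_P_fin] by simp
    have "enn2real (\<integral>\<^sup>+x. ennreal (norm (h x) powr p) \<partial>\<mu>) \<le> enn2real (\<integral>\<^sup>+x. P x \<partial>\<mu>)"
      using int_P_fin by (intro enn2real_mono[OF int_h]) simp
    then have "Lp_norm \<mu> p h \<le> enn2real (\<integral>\<^sup>+x. P x \<partial>\<mu>) powr (1 / p)"
      using p by (subst Lp_norm_eq) (auto intro: powr_mono2)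
    also have "\<dots> = Lp_norm \<mu> p f * Lp_norm \<mu> p g"
      by (simp add: Lp_norm_eq int_P enn2real_mult powr_mult)
    finally show "Lp_norm \<mu> p h \<le> Lp_norm \<mu> p f * Lp_norm \<mu> p g" .
  qed (simp add: h_eq)
qed

end

section \<open>A scalar convolution inequality\<close>

text \<open>With \<open>A\<close> the full sum, each \<open>a j powr p\<close> is
  \<open>a j * a j powr (p - 1)\<close>, hence at most \<open>a j * A powr (p - 1)\<close>. This
  later separates the functions \<open>W j\<close> inside the p-th power.\<close>

lemma sum_powr_le_powr_sum:
  fixes a :: "'b \<Rightarrow> real"
  assumes "finite J" "1 \<le> p" "\<And>j. j \<in> J \<Longrightarrow> 0 \<le> a j"
  shows "(\<Sum>j\<in>J. a j powr p) \<le> (\<Sum>j\<in>J. a j) powr p"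
proof -
  define A where "A = (\<Sum>j\<in>J. a j)"
  have split: "v powr p = v * v powr (p - 1)" if "0 \<le> v" for v :: real
    using that by (cases "v = 0") (auto simp: powr_diff)
  have "a j powr p \<le> a j * A powr (p - 1)" if "j \<in> J" for j
    unfolding split[OF assms(3)[OF that]] A_def using assms that
    by (intro mult_left_mono powr_mono2 member_le_sum) auto
  then have "(\<Sum>j\<in>J. a j powr p) \<le> (\<Sum>j\<in>J. a j * A powr (p - 1))"
    by (rule sum_mono)
  also have "\<dots> = A powr p"
    using assms by (subst split) (auto simp: A_def sum_distrib_right intro: sum_nonneg)
  finally show ?thesis by (simp add: A_def)
qed

text \<open>A lacunary sum is comparable to its first nonzero term.\<close>

lemma lacunary_sum_powr_le:
  fixes a :: "nat \<Rightarrow> real"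
  assumes p: "0 \<le> p" and a: "\<And>m. 0 \<le> a m" "\<And>m. a (Suc m) \<le> a m / 2"
  shows "(\<Sum>m<N. a m * indicat_real S m) powr p \<le> 2 powr p * (\<Sum>m<N. a m powr p * indicat_real S m)"
proof (cases "\<exists>m<N. m \<in> S")
  case True
  define j where "j = (LEAST m. m < N \<and> m \<in> S)"
  have j: "j < N" "j \<in> S"
    using LeastI_ex[OF True] by (auto simp: j_def)
  have least: "j \<le> m" if "m < N" "m \<in> S" for m
    unfolding j_def using that by (intro Least_le) auto
  have "(\<Sum>m<N. a m * indicat_real S m) \<le> (\<Sum>m=j..<N. a m)"
  proof -
    have "(\<Sum>m<N. a m * indicat_real S m) = (\<Sum>m\<in>{..<N} \<inter> S. a m)"
      by (simp add: sum.inter_restrict indicator_def if_distrib cong: if_cong)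
    also have "\<dots> \<le> (\<Sum>m=j..<N. a m)"
      using a(1) by (intro sum_mono2) (auto dest: least)
    finally show ?thesis .
  qed
  \<comment> \<open>Subtracting \<open>2 * a N\<close> strengthens the bound so that the induction
    on \<open>N\<close> closes under halving.\<close>
  also have "(\<Sum>m=j..<N. a m) \<le> 2 * a j - 2 * a N"
    using less_imp_le[OF j(1)]
  proof (induction N rule: dec_induct)
    case (step n)
    then show ?case using a(2)[of n] by simp
  qed simp
  also have "\<dots> \<le> 2 * a j" using a(1)[of N] by simp
  finally have "(\<Sum>m<N. a m * indicat_real S m) powr p \<le> (2 * a j) powr p"
    using p a(1) by (intro powr_mono2) (auto intro!: sum_nonneg)
  also have "\<dots> = 2 powr p * (a j powr p * indicat_real S j)"
    using j a(1) by (simp add: powr_mult)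
  also have "\<dots> \<le> 2 powr p * (\<Sum>m<N. a m powr p * indicat_real S m)"
    using j(1) by (intro mult_left_mono member_le_sum) auto
  finally show ?thesis .
next
  case False
  then have "(\<Sum>m<N. a m * indicat_real S m) = 0"
    by (intro sum.neutral) (auto simp: indicator_def)
  then show ?thesis by (simp add: sum_nonneg)
qed

text \<open>If a character does not vanish at \<open>a\<close>, it takes the nonzero value
  \<open>\<phi> a * \<phi> a\<close> at \<open>a * a\<close>. This is how the existence of a
  character enters the proof.\<close>

lemma character_imp_square_nonzero:
  assumes "(characters :: ('a::complex_banach_algebra \<Rightarrow> complex) set) \<noteq> {}"
  shows "\<exists>a::'a. a * a \<noteq> 0"
proof -
  obtain \<phi> :: "'a \<Rightarrow> complex" where \<phi>: "Vector_Spaces.linear scaleC (*) \<phi>"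
      "\<And>x y. \<phi> (x * y) = \<phi> x * \<phi> y" "\<phi> \<noteq> (\<lambda>_. 0)"
    using assms by (auto simp: characters_def)
  have "\<phi> (0 + 0) = \<phi> 0 + \<phi> 0"
    using \<phi>(1) unfolding Vector_Spaces.linear_iff by blast
  then have "\<phi> 0 = 0" by simp
  moreover obtain a where "\<phi> a \<noteq> 0"
    using \<phi>(3) by auto
  ultimately show ?thesis
    using \<phi>(2)[of a a] by (intro exI[of _ a]) auto
qed

section \<open>Covering and packing by translates\<close>

lemma compact_set_plus:
  fixes A B :: "'g::topological_monoid_add set"
  assumes "compact A" "compact B"
  shows "compact (A + B)"
proof -
  have "compact ((\<lambda>z. fst z + snd z) ` (A \<times> B))"
    using assms by (intro compact_continuous_image compact_Times continuous_intros)
  also have "(\<lambda>z. fst z + snd z) ` (A \<times> B) = A + B"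
    by (force simp: set_plus_def)
  finally show ?thesis .
qed

lemma set_plus_eq_UN: "A + B = (\<Union>x\<in>A. (+) x ` B)"
  by (auto simp: set_plus_def)

lemma open_translate:
  fixes U :: "'g::topological_group_add set"
  assumes "open U" shows "open ((+) x ` U)"
proof -
  have "open ((\<lambda>y. - x + y) -` U)"
    using assms by (intro open_vimage continuous_intros)
  also have "(\<lambda>y. - x + y) -` U = (+) x ` U"
    by (auto simp: image_iff add.assoc[symmetric] intro!: bexI[of _ "- x + _"])
  finally show ?thesis .
qed

lemma compact_subset_finite_plus:
  fixes K :: "'g::topological_group_add set"
  assumes "compact K" "open U" "0 \<in> U"
  obtains X where "finite X" "X \<subseteq> K" "K \<subseteq> X + U"
proof -
  have "\<forall>x\<in>K. open ((+) x ` U)" using assms(2) by (simp add: open_translate)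
  moreover have "K \<subseteq> (\<Union>x\<in>K. (+) x ` U)" using assms(3) by (force simp: image_iff)
  ultimately obtain X where "X \<subseteq> K" "finite X" "K \<subseteq> (\<Union>x\<in>X. (+) x ` U)"
    using compactE_image[OF assms(1)] by metis
  then show ?thesis by (intro that) (auto simp: set_plus_eq_UN)
qed

context left_haar
begin

lemma compact_borel: "compact K \<Longrightarrow> K \<in> sets (borel :: 'g measure)"
  by (intro borel_closed compact_imp_closed)

lemma emeasure_eq_measure_compact: "compact K \<Longrightarrow> emeasure \<mu> K = ennreal (measure \<mu> K)"
  using emeasure_compact[of K] by (simp add: emeasure_eq_ennreal_measure top.not_eq_extremum)

lemma emeasure_finite_plus_le:
  assumes "finite X" "B \<in> sets borel"
  shows "emeasure \<mu> (X + B) \<le> of_nat (card X) * emeasure \<mu> B"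
proof -
  have "emeasure \<mu> (\<Union>x\<in>X. (+) x ` B) \<le> (\<Sum>x\<in>X. emeasure \<mu> ((+) x ` B))"
    using assms by (intro emeasure_subadditive_finite) (auto intro: borel_translate)
  then show ?thesis
    using assms by (simp add: set_plus_eq_UN emeasure_translate)
qed

lemma measure_le_card_mult:
  assumes "finite X" "compact B" "A \<in> sets borel" "A \<subseteq> X + B"
  shows "measure \<mu> A \<le> real (card X) * measure \<mu> B"
proof -
  have "compact (X + B)"
    using assms by (intro compact_set_plus[OF finite_imp_compact])
  then have "emeasure \<mu> A \<le> emeasure \<mu> (X + B)"
    using assms compact_borel by (intro emeasure_mono) auto
  also have "\<dots> \<le> of_nat (card X) * emeasure \<mu> B"
    using assms compact_borel by (intro emeasure_finite_plus_le)
  also have "\<dots> = ennreal (real (card X) * measure \<mu> B)"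
    using assms by (simp add: emeasure_eq_measure_compact ennreal_mult' ennreal_of_nat_eq_real_of_nat)
  finally show ?thesis
    by (simp add: measure_def enn2real_leI)
qed

text \<open>If \<open>U\<close> were null, then so would be every compact set, being covered by
  finitely many translates of \<open>U\<close>; inner regularity of the whole group would make
  \<open>\<mu>\<close> zero.\<close>

lemma emeasure_open_pos:
  assumes "open U" "0 \<in> U" shows "emeasure \<mu> U > 0"
proof (rule ccontr)
  assume "\<not> emeasure \<mu> U > 0"
  then have U: "emeasure \<mu> U = 0" by simp
  have "emeasure \<mu> K = 0" if K: "compact K" for K
  proof -
    obtain X where X: "finite X" "K \<subseteq> X + U"
      using compact_subset_finite_plus[OF K assms] .
    have "open (X + U)"
      using assms by (auto simp: set_plus_eq_UN intro: open_translate)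
    then have "emeasure \<mu> K \<le> emeasure \<mu> (X + U)"
      using X by (intro emeasure_mono) auto
    also have "\<dots> \<le> of_nat (card X) * emeasure \<mu> U"
      using X assms by (intro emeasure_finite_plus_le) auto
    finally show ?thesis using U by simp
  qed
  then have "emeasure \<mu> UNIV = 0"
    by (subst inner_regular) (auto intro!: SUP_eq_const[THEN trans] exI[of _ "{}"] simp: SUP_eq_iff)
  then show False
    using left_Haar by (simp add: left_Haar_measure_def)
qed

text \<open>Disjoint translates of \<open>V\<close> inside \<open>T\<close> are bounded in number by
  measure, so there is a family of maximal cardinality. By maximality \<open>q + V\<close> meets
  some \<open>x + V\<close> for each new \<open>q\<close>, and the symmetry of \<open>V\<close> puts
  \<open>q\<close> into \<open>x + (V + V)\<close>.\<close>

lemma finite_packing: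
  assumes V: "V \<in> sets borel" "uminus ` V = V" "0 \<in> V" "0 < emeasure \<mu> V"
    and T: "T \<in> sets borel" "S + V \<subseteq> T" "emeasure \<mu> T < \<infinity>"
  obtains X where "finite X" "X \<subseteq> S" "disjoint_family_on (\<lambda>x. (+) x ` V) X" "S \<subseteq> X + (V + V)"
proof -
  define \<P> where "\<P> X \<longleftrightarrow> finite X \<and> X \<subseteq> S \<and> disjoint_family_on (\<lambda>x. (+) x ` V) X" for X
  have bound: "of_nat (card X) * emeasure \<mu> V \<le> emeasure \<mu> T" if "\<P> X" for X
  proof -
    have "of_nat (card X) * emeasure \<mu> V = (\<Sum>x\<in>X. emeasure \<mu> ((+) x ` V))"
      using V by (simp add: emeasure_translate)
    also have "\<dots> = emeasure \<mu> (\<Union>x\<in>X. (+) x ` V)"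
      using that V by (intro sum_emeasure) (auto simp: \<P>_def intro: borel_translate)
    also have "\<dots> \<le> emeasure \<mu> T"
      using that T by (intro emeasure_mono) (auto simp: \<P>_def set_plus_eq_UN)
    finally show ?thesis .
  qed
  obtain t where t: "emeasure \<mu> T = ennreal t" "0 \<le> t"
    using T(3) by (cases "emeasure \<mu> T") auto
  \<comment> \<open>A positive real below the measure of \<open>V\<close>, which the hypotheses
    allow to be infinite.\<close>
  obtain v where v: "0 < v" "ennreal v \<le> emeasure \<mu> V"
  proof (cases "emeasure \<mu> V")
    case (real r)
    then show ?thesis using V(4) by (intro that[of r]) auto
  next
    case top
    then show ?thesis by (intro that[of 1]) auto
  qed
  have "card X \<le> nat \<lceil>t / v\<rceil>" if "\<P> X" for X
  proof -
    have "ennreal (real (card X) * v) = of_nat (card X) * ennreal v"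
      using v by (simp add: ennreal_mult' ennreal_of_nat_eq_real_of_nat)
    also have "\<dots> \<le> of_nat (card X) * emeasure \<mu> V"
      using v by (intro mult_left_mono) auto
    also have "\<dots> \<le> ennreal t" using bound[OF that] t by simp
    finally have "real (card X) * v \<le> t" using t by simp
    then have "real (card X) \<le> t / v" using v by (simp add: field_simps)
    then show ?thesis by linarith
  qed
  moreover have "\<P> {}" by (simp add: \<P>_def disjoint_family_on_def)
  ultimately obtain X where X: "\<P> X" and max: "\<And>Y. \<P> Y \<Longrightarrow> card Y \<le> card X"
    using ex_has_greatest_nat[of \<P> "{}" card "Suc (nat \<lceil>t / v\<rceil>)"] by (metis le_imp_less_Suc)
  have "q \<in> X + (V + V)" if q: "q \<in> S" for q
  proof (cases "q \<in> X")
    case True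
    have "q + (0 + 0) \<in> X + (V + V)" using True V(3) by (intro set_plus_intro)
    then show ?thesis by simp
  next
    case False
    have "\<not> \<P> (insert q X)"
      using max[of "insert q X"] X False by (auto simp: \<P>_def)
    then have "\<not> disjoint_family_on (\<lambda>x. (+) x ` V) (insert q X)"
      using X q by (auto simp: \<P>_def)
    then obtain x where x: "x \<in> X" "(+) q ` V \<inter> (+) x ` V \<noteq> {}"
      using X False by (auto simp: disjoint_family_on_insert \<P>_def)
    then obtain v v' where v: "v \<in> V" "v' \<in> V" "q + v = x + v'" by auto
    have "q = x + (v' + - v)"
      using v(3) by (metis add.assoc add_diff_cancel diff_conv_add_uminus)
    moreover have "- v \<in> V" using v(1) V(2) by blast
    ultimately show ?thesis using x(1) v(2) by (metis set_plus_intro)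
  qed
  then show ?thesis using X by (intro that[of X]) (auto simp: \<P>_def)
qed

text \<open>A packing of the whole group is finite, so the group is covered by finitely many
  translates of the compact set \<open>V + V\<close>.\<close>

lemma compact_if_finite_measure:
  fixes U V :: "'g set"
  assumes V: "compact V" "uminus ` V = V" "open U" "0 \<in> U" "U \<subseteq> V"
    and "emeasure \<mu> UNIV < \<infinity>"
  shows "compact (UNIV :: 'g set)"
proof -
  have "0 < emeasure \<mu> U" using V by (intro emeasure_open_pos)
  also have "\<dots> \<le> emeasure \<mu> V" using V compact_borel by (intro emeasure_mono) auto
  finally have "0 < emeasure \<mu> V" .
  have "\<exists>X. finite X \<and> UNIV \<subseteq> X + (V + V)"
    by (rule finite_packing[of V UNIV UNIV])
      (use V assms(6) compact_borel[of V] \<open>0 < emeasure \<mu> V\<close> in \<open>auto simp: subset_iff\<close>)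
  then obtain X where X: "finite X" "UNIV \<subseteq> X + (V + V)"
    by blast
  then have "UNIV = X + (V + V)" by auto
  moreover have "compact (X + (V + V))"
    using X V by (intro compact_set_plus[OF finite_imp_compact] compact_set_plus)
  ultimately show ?thesis by simp
qed

text \<open>The bound is in terms of p-th powers and concerns measurable minorants \<open>w\<close>,
  so it can be applied without discussing the measurability of the convolution itself.\<close>

definition convolution_bounded :: "real \<Rightarrow> real \<Rightarrow> bool" where
  "convolution_bounded p C \<longleftrightarrow>
    (\<forall>u\<in>borel_measurable borel. \<forall>v\<in>borel_measurable borel. \<forall>w\<in>borel_measurable borel.
      (\<forall>x. 0 \<le> u x \<and> 0 \<le> v x \<and> 0 \<le> (w x :: real)) \<longrightarrow>
      (\<integral>\<^sup>+x. ennreal (u x powr p) \<partial>\<mu>) < \<infinity> \<longrightarrow> (\<integral>\<^sup>+x. ennreal (v x powr p) \<partial>\<mu>) < \<infinity> \<longrightarrow>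
      (\<forall>x. ennreal (w x) \<le> (\<integral>\<^sup>+y. ennreal (u y * v (- y + x)) \<partial>\<mu>)) \<longrightarrow>
      (\<integral>\<^sup>+x. ennreal (w x powr p) \<partial>\<mu>) \<le>
        ennreal C * ((\<integral>\<^sup>+x. ennreal (u x powr p) \<partial>\<mu>) * (\<integral>\<^sup>+x. ennreal (v x powr p) \<partial>\<mu>)))"

text \<open>For \<open>f = u a\<close> and \<open>g = v a\<close> the convolution is the scalar
  convolution of \<open>u\<close> and \<open>v\<close> times \<open>a * a\<close>; comparing norms
  produces the constant.\<close>

lemma Lp_is_banach_algebra_imp_convolution_bounded:
  fixes a :: "'a::separable_complex_banach_algebra"
  assumes "Lp_is_banach_algebra TYPE('a) \<mu> p" and a: "a * a \<noteq> 0" and p: "1 < p"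
  shows "convolution_bounded p ((norm a * norm a / norm (a * a)) powr p)"
  unfolding convolution_bounded_def
proof (intro ballI impI)
  fix u v w :: "'g \<Rightarrow> real"
  assume uvw[measurable]: "u \<in> borel_measurable borel" "v \<in> borel_measurable borel" "w \<in> borel_measurable borel"
    and nonneg: "\<forall>x. 0 \<le> u x \<and> 0 \<le> v x \<and> 0 \<le> w x"
    and u_fin: "(\<integral>\<^sup>+x. ennreal (u x powr p) \<partial>\<mu>) < \<infinity>"
    and v_fin: "(\<integral>\<^sup>+x. ennreal (v x powr p) \<partial>\<mu>) < \<infinity>"
    and w: "\<forall>x. ennreal (w x) \<le> (\<integral>\<^sup>+y. ennreal (u y * v (- y + x)) \<partial>\<mu>)"
  define A where "A u = (\<integral>\<^sup>+x. ennreal (u x powr p) \<partial>\<mu>)" for u :: "'g \<Rightarrow> real"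
  define b where "b = norm (a * a)"
  have b: "0 < b" using a by (simp add: b_def)
  have A_scale: "(\<integral>\<^sup>+x. ennreal (norm (k x *\<^sub>R c) powr p) \<partial>\<mu>) = ennreal (norm c powr p) * A k"
    if [measurable]: "k \<in> borel_measurable borel" and "\<forall>x. 0 \<le> k x" for k and c :: 'a
  proof -
    have "(\<integral>\<^sup>+x. ennreal (norm (k x *\<^sub>R c) powr p) \<partial>\<mu>)
        = (\<integral>\<^sup>+x. ennreal (norm c powr p) * ennreal (k x powr p) \<partial>\<mu>)"
      using that by (intro nn_integral_cong) (simp add: powr_mult ennreal_mult' mult.commute)
    then show ?thesis unfolding A_def by (simp add: nn_integral_cmult)
  qed
  define f where "f x = u x *\<^sub>R a" for x
  define g where "g x = v x *\<^sub>R a" for x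
  have [measurable]: "f \<in> borel_measurable borel" "g \<in> borel_measurable borel"
    unfolding f_def g_def by measurable
  have Af: "(\<integral>\<^sup>+x. ennreal (norm (f x) powr p) \<partial>\<mu>) = ennreal (norm a powr p) * A u"
    and Ag: "(\<integral>\<^sup>+x. ennreal (norm (g x) powr p) \<partial>\<mu>) = ennreal (norm a powr p) * A v"
    unfolding f_def g_def using nonneg uvw A_scale[of u a] A_scale[of v a] by blast+
  have uv_fin: "A u < \<infinity>" "A v < \<infinity>"
    using u_fin v_fin by (auto simp: A_def)
  have "f \<in> Lp_space \<mu> p" "g \<in> Lp_space \<mu> p"
    using uv_fin by (auto simp: Lp_space_def Af Ag ennreal_mult_less_top)
  then obtain h where "AE x in \<mu>. convolution_defined_at \<mu> f g x"
    and h: "h \<in> Lp_space \<mu> p" "AE x in \<mu>. h x = convolution \<mu> f g x"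
      "Lp_norm \<mu> p h \<le> Lp_norm \<mu> p f * Lp_norm \<mu> p g"
    using assms(1) unfolding Lp_is_banach_algebra_def by metis
  have [measurable]: "h \<in> borel_measurable \<mu>"
    using h(1) by (simp add: Lp_space_def)
  have h_fin: "(\<integral>\<^sup>+x. ennreal (norm (h x) powr p) \<partial>\<mu>) < \<infinity>"
    using h(1) by (simp add: Lp_space_def)
  have [measurable]: "(\<lambda>y. v (- y + x)) \<in> borel_measurable borel" for x
    using measurable_compose[OF measurable_diff_left, of v borel x] by simp
  have ineq: "AE x in \<mu>. norm (w x *\<^sub>R (a * a)) \<le> norm (h x)"
    using \<open>AE x in \<mu>. convolution_defined_at \<mu> f g x\<close> h(2)
  proof eventually_elim
    case (elim x)
    define k where "k y = u y * v (- y + x)" for y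
    have k[measurable]: "k \<in> borel_measurable borel" unfolding k_def by measurable
    have k_nonneg: "0 \<le> k y" for y using nonneg by (simp add: k_def)
    have fg: "f y * g (- y + x) = k y *\<^sub>R (a * a)" for y
      by (simp add: f_def g_def k_def)
    have "integrable \<mu> (\<lambda>y. k y *\<^sub>R (a * a))"
      using elim(1) by (simp add: convolution_defined_at_def fg)
    \<comment> \<open>Taking norms and dividing by \<open>b = norm (a * a)\<close> recovers the
      nonnegative scalar integrand \<open>k\<close>.\<close>
    then have "integrable \<mu> (\<lambda>y. norm (k y *\<^sub>R (a * a)) / b)"
      by (intro integrable_divide integrable_norm) auto
    then have int_k: "integrable \<mu> k"
      using b k_nonneg by (simp add: b_def)
    have "ennreal (w x) \<le> (\<integral>\<^sup>+y. ennreal (k y) \<partial>\<mu>)"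
      using w by (simp add: k_def)
    also have "\<dots> = ennreal (\<integral>y. k y \<partial>\<mu>)"
      using int_k k_nonneg by (intro nn_integral_eq_integral) auto
    finally have "w x \<le> (\<integral>y. k y \<partial>\<mu>)"
      using k_nonneg by (simp add: ennreal_le_iff Bochner_Integration.integral_nonneg)
    moreover have "h x = (\<integral>y. k y \<partial>\<mu>) *\<^sub>R (a * a)"
      using elim(2) int_k by (simp add: convolution_def fg)
    ultimately show ?case
      using nonneg by (auto intro!: mult_right_mono)
  qed
  have "ennreal (b powr p) * A w = (\<integral>\<^sup>+x. ennreal (norm (w x *\<^sub>R (a * a)) powr p) \<partial>\<mu>)"
    unfolding b_def using nonneg by (intro A_scale[symmetric]) auto
  also have "\<dots> \<le> (\<integral>\<^sup>+x. ennreal (norm (h x) powr p) \<partial>\<mu>)"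
    using ineq p by (intro nn_integral_mono_AE) (auto elim!: eventually_mono intro!: ennreal_leI powr_mono2)
  \<comment> \<open>Finiteness of the integral matters, since \<open>enn2real\<close> sends infinity
    to 0.\<close>
  also have "\<dots> = ennreal (Lp_norm \<mu> p h powr p)"
    using p h_fin by (simp add: Lp_norm_eq powr_powr)
  also have "\<dots> \<le> ennreal ((Lp_norm \<mu> p f * Lp_norm \<mu> p g) powr p)"
    using h(3) p by (intro ennreal_leI powr_mono2) (auto simp: Lp_norm_def)
  also have "\<dots> = ennreal (norm a powr p) * A u * (ennreal (norm a powr p) * A v)"
  proof -
    have "(Lp_norm \<mu> p f * Lp_norm \<mu> p g) powr p =
        enn2real (ennreal (norm a powr p) * A u * (ennreal (norm a powr p) * A v))"
      using p by (simp add: Lp_norm_eq Af Ag powr_mult powr_powr enn2real_mult)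
    then show ?thesis
      using uv_fin by (simp add: ennreal_mult_less_top)
  qed
  finally have le: "ennreal (b powr p) * A w \<le> ennreal (norm a powr p) * A u * (ennreal (norm a powr p) * A v)" .
  have "A w = ennreal (b powr (- p)) * (ennreal (b powr p) * A w)"
    using b by (simp add: mult.assoc[symmetric] ennreal_mult''[symmetric] powr_add[symmetric])
  also have "\<dots> \<le> ennreal (b powr (- p)) * (ennreal (norm a powr p) * A u * (ennreal (norm a powr p) * A v))"
    by (intro mult_left_mono le) auto
  also have "\<dots> = ennreal (b powr (- p)) * ennreal (norm a powr p) * ennreal (norm a powr p) * (A u * A v)"
    by (simp add: ac_simps)
  also have "ennreal (b powr (- p)) * ennreal (norm a powr p) * ennreal (norm a powr p)
      = ennreal ((norm a * norm a / b) powr p)"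
    using b by (simp add: ennreal_mult''[symmetric] powr_mult powr_divide powr_minus field_simps)
  finally show "(\<integral>\<^sup>+x. ennreal (w x powr p) \<partial>\<mu>) \<le> ennreal ((norm a * norm a / norm (a * a)) powr p) *
      ((\<integral>\<^sup>+x. ennreal (u x powr p) \<partial>\<mu>) * (\<integral>\<^sup>+x. ennreal (v x powr p) \<partial>\<mu>))"
    by (simp add: A_def b_def)
qed

end

section \<open>Powers of a compact neighbourhood\<close>

text \<open>\<open>V\<close> is the piece used for packings, \<open>U\<close> ensures that it has
  positive measure, and \<open>K\<close> can be chosen as large as needed.\<close>

locale haar_neighborhoods = left_haar \<mu> for \<mu> :: "'a::{topological_group_add, t2_space} measure" +
  fixes V K U :: "'a set"
  assumes compact_V: "compact V" and sym_V: "uminus ` V = V"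
    and open_U: "open U" and zero_U: "0 \<in> U" and U_subset: "U \<subseteq> V"
    and compact_K: "compact K" and sym_K: "uminus ` K = K" and V_plus_V: "V + V \<subseteq> K"
begin

text \<open>\<open>Q m\<close> is \<open>K\<^sup>m\<^sup>+\<^sup>1\<close> in multiplicative notation.\<close>

primrec Q :: "nat \<Rightarrow> 'a set" where
  "Q 0 = K"
| "Q (Suc m) = K + Q m"

definition s :: "nat \<Rightarrow> real" where "s m = measure \<mu> (Q m)"

lemma zero_V: "0 \<in> V"
  using zero_U U_subset by blast

lemma V_subset_K: "V \<subseteq> K"
proof
  fix v assume "v \<in> V"
  then have "v + 0 \<in> V + V" using zero_V by (rule set_plus_intro)
  then show "v \<in> K" using V_plus_V by auto
qed

lemma zero_K: "0 \<in> K"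
  using zero_V V_subset_K by blast

lemma compact_Q: "compact (Q m)"
  by (induction m) (auto intro: compact_set_plus compact_K)

lemma Q_borel [measurable]: "Q m \<in> sets borel"
  by (rule compact_borel[OF compact_Q])

text \<open>Because of the index shift, the exponents \<open>m + 1\<close> and \<open>n + 1\<close>
  add up to \<open>m + n + 2\<close>.\<close>

lemma Q_plus_Q: "Q m + Q n = Q (Suc (m + n))"
  by (induction m) (auto simp: add.assoc)

lemma K_subset_Q: "K \<subseteq> Q m"
proof (induction m)
  case (Suc m)
  have "k + 0 \<in> K + Q m" if "k \<in> K" for k
    using that Suc zero_K by (intro set_plus_intro) auto
  then show ?case by auto
qed simp

lemma emeasure_Q: "emeasure \<mu> (Q m) = ennreal (s m)"
  unfolding s_def by (rule emeasure_eq_measure_compact[OF compact_Q])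

lemma emeasure_V: "emeasure \<mu> V = ennreal (measure \<mu> V)"
  by (rule emeasure_eq_measure_compact[OF compact_V])

lemma emeasure_V_pos: "0 < emeasure \<mu> V"
proof -
  have "0 < emeasure \<mu> U" using open_U zero_U by (rule emeasure_open_pos)
  also have "\<dots> \<le> emeasure \<mu> V" using U_subset compact_borel[OF compact_V] by (intro emeasure_mono) auto
  finally show ?thesis .
qed

lemma measure_V_pos: "0 < measure \<mu> V"
  using emeasure_V_pos by (simp add: emeasure_V)

lemma s_pos: "0 < s m"
proof -
  have "emeasure \<mu> V \<le> emeasure \<mu> (Q m)"
    using V_subset_K K_subset_Q[of m] by (intro emeasure_mono) auto
  then have "0 < emeasure \<mu> (Q m)"
    by (rule less_le_trans[OF emeasure_V_pos])
  then show ?thesis by (simp add: emeasure_Q)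
qed

text \<open>Finitely many translates of \<open>K\<close> cover \<open>K + K\<close>. Adding a
  further power of \<open>K\<close> on the right preserves this cover, so the number of translates
  serves for all \<open>m\<close>.\<close>

lemma s_doubling: "\<exists>D>0. \<forall>m. s (Suc m) \<le> D * s m"
proof -
  obtain X where X: "finite X" "K + K \<subseteq> X + U"
    using compact_subset_finite_plus[OF compact_set_plus[OF compact_K compact_K] open_U zero_U] .
  have KX: "K + K \<subseteq> X + K"
    using X(2) U_subset V_subset_K set_plus_mono2[of X X U K] by blast
  have "Q (Suc m) \<subseteq> X + Q m" for m
  proof (cases m)
    case (Suc n)
    have "K + K + Q n \<subseteq> X + K + Q n"
      using KX by (rule set_plus_mono2) simp
    then show ?thesis using Suc by (simp add: add.assoc)
  qed (use KX in simp)
  then have le: "s (Suc m) \<le> real (card X) * s m" for m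
    unfolding s_def using X(1) by (intro measure_le_card_mult compact_Q Q_borel)
  moreover have "0 < real (card X)"
    using less_le_trans[OF s_pos le] s_pos[of 0] by (simp add: zero_less_mult_iff)
  ultimately show ?thesis by blast
qed

lemma packing:
  obtains X where "finite X" "X \<subseteq> Q m" "disjoint_family_on (\<lambda>x. (+) x ` V) X" "Q m \<subseteq> X + K"
proof -
  have "Q m + V \<subseteq> Q m + Q 0"
    using V_subset_K by (intro set_plus_mono2) auto
  then have "Q m + V \<subseteq> Q (Suc m)" by (simp only: Q_plus_Q) simp
  then obtain X where X: "finite X" "X \<subseteq> Q m" "disjoint_family_on (\<lambda>x. (+) x ` V) X" "Q m \<subseteq> X + (V + V)"
    using finite_packing[of V "Q (Suc m)" "Q m"] compact_borel[OF compact_V] sym_V zero_V emeasure_V_pos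
      Q_borel[of "Suc m"] emeasure_Q[of "Suc m"] by (metis ennreal_less_top infinity_ennreal_def)
  have "X + (V + V) \<subseteq> X + K"
    using V_plus_V by (intro set_plus_mono2) auto
  then show ?thesis using X by (intro that[of X]) auto
qed

text \<open>A discrete stand-in for \<open>Q m\<close> as the left factor of a convolution.\<close>

definition X :: "nat \<Rightarrow> 'a set" where
  "X m = (SOME X. finite X \<and> X \<subseteq> Q m \<and> disjoint_family_on (\<lambda>x. (+) x ` V) X \<and> Q m \<subseteq> X + K)"

lemma packing_X: "finite (X m)" "X m \<subseteq> Q m" "disjoint_family_on (\<lambda>x. (+) x ` V) (X m)" "Q m \<subseteq> X m + K"
proof -
  have "\<exists>X. finite X \<and> X \<subseteq> Q m \<and> disjoint_family_on (\<lambda>x. (+) x ` V) X \<and> Q m \<subseteq> X + K"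
    by (rule packing) blast
  from someI_ex[OF this] show "finite (X m)" "X m \<subseteq> Q m"
      "disjoint_family_on (\<lambda>x. (+) x ` V) (X m)" "Q m \<subseteq> X m + K"
    unfolding X_def by blast+
qed

lemma s_le_card: "s m \<le> real (card (X m)) * s 0"
  unfolding s_def using packing_X[of m] compact_K by (intro measure_le_card_mult) auto

text \<open>The translates of \<open>Q (Suc n)\<close> by \<open>X m\<close> cover
  \<open>Q m + Q n\<close>. Together with doubling this bounds \<open>card (X m) * s n\<close> from
  below.\<close>

lemma s_add_le_card: "s (Suc (m + n)) \<le> real (card (X m)) * s (Suc n)"
proof -
  have "Q m + Q n \<subseteq> X m + K + Q n"
    using packing_X(4) by (intro set_plus_mono2) auto
  then have "Q (Suc (m + n)) \<subseteq> X m + Q (Suc n)"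
    by (simp add: Q_plus_Q add.assoc del: Q.simps(2)) (simp add: add.assoc)
  then show ?thesis
    unfolding s_def using packing_X(1) by (intro measure_le_card_mult compact_Q Q_borel)
qed

text \<open>If \<open>z \<in> x + Q n\<close> with \<open>x \<in> X m\<close>, the integrand is 1 on
  all of \<open>x + V\<close>. These translates of \<open>V\<close> are disjoint, so each such
  \<open>x\<close> contributes \<open>measure \<mu> V\<close>.\<close>

lemma convolution_indicator_ge:
  "ennreal (measure \<mu> V * (\<Sum>x\<in>X m. indicator ((+) x ` Q n) z))
    \<le> (\<integral>\<^sup>+y. indicator (Q (Suc m)) y * indicator (Q (Suc n)) (- y + z) \<partial>\<mu>)"
proof -
  define X' where "X' = {x\<in>X m. z \<in> (+) x ` Q n}"
  have X': "finite X'" "X' \<subseteq> X m" using packing_X(1) by (auto simp: X'_def)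
  have "(\<Sum>x\<in>X m. indicator ((+) x ` Q n) z) = real (card X')"
    using packing_X(1)[of m] by (simp add: indicator_def X'_def sum.If_cases Int_def)
  then have "ennreal (measure \<mu> V * (\<Sum>x\<in>X m. indicator ((+) x ` Q n) z)) = of_nat (card X') * emeasure \<mu> V"
    by (simp add: emeasure_V ennreal_mult' mult.commute ennreal_of_nat_eq_real_of_nat)
  also have "\<dots> = (\<Sum>x\<in>X'. emeasure \<mu> ((+) x ` V))"
    using compact_borel[OF compact_V] by (simp add: emeasure_translate)
  also have "\<dots> = emeasure \<mu> (\<Union>x\<in>X'. (+) x ` V)"
    using X' disjoint_family_on_mono[OF X'(2) packing_X(3)] compact_borel[OF compact_V]
    by (intro sum_emeasure) (auto intro: borel_translate)
  also have "\<dots> = (\<integral>\<^sup>+y. indicator (\<Union>x\<in>X'. (+) x ` V) y \<partial>\<mu>)"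
    using X' compact_borel[OF compact_V] by (intro nn_integral_indicator[symmetric]) (auto intro: borel_translate)
  also have "\<dots> \<le> (\<integral>\<^sup>+y. indicator (Q (Suc m)) y * indicator (Q (Suc n)) (- y + z) \<partial>\<mu>)"
  proof (rule nn_integral_mono)
    fix y
    show "(indicator (\<Union>x\<in>X'. (+) x ` V) y :: ennreal) \<le> indicator (Q (Suc m)) y * indicator (Q (Suc n)) (- y + z)"
    proof (cases "y \<in> (\<Union>x\<in>X'. (+) x ` V)")
      case True
      then obtain x v q where xv: "x \<in> X m" "v \<in> V" "y = x + v" "q \<in> Q n" "z = x + q"
        by (auto simp: X'_def)
      have "y \<in> Q m + Q 0"
        unfolding xv(3) using xv packing_X(2)[of m] V_subset_K by (intro set_plus_intro) auto
      then have "y \<in> Q (Suc m)" by (simp only: Q_plus_Q) simp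
      moreover have "- y + z = - v + q"
        by (simp only: xv minus_add add.assoc minus_add_cancel)
      moreover have "- v \<in> K"
        using xv(2) sym_V V_subset_K by blast
      then have "- v + q \<in> Q (Suc n)"
        using xv(4) by (auto intro: set_plus_intro)
      ultimately show ?thesis using True by (simp del: Q.simps)
    qed simp
  qed
  finally show ?thesis .
qed

lemma nn_integral_sum_indicator:
  "(\<integral>\<^sup>+z. ennreal (\<Sum>x\<in>X m. indicator ((+) x ` Q n) z) \<partial>\<mu>) = ennreal (real (card (X m)) * s n)"
proof -
  have [measurable]: "(+) x ` Q n \<in> sets borel" for x
    by (rule borel_translate[OF Q_borel])
  have "(\<integral>\<^sup>+z. ennreal (\<Sum>x\<in>X m. indicator ((+) x ` Q n) z) \<partial>\<mu>)
      = (\<integral>\<^sup>+z. (\<Sum>x\<in>X m. indicator ((+) x ` Q n) z) \<partial>\<mu>)"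
    by (simp add: sum_ennreal[symmetric] ennreal_indicator)
  also have "\<dots> = (\<Sum>x\<in>X m. emeasure \<mu> ((+) x ` Q n))"
    by (subst nn_integral_sum) auto
  also have "\<dots> = ennreal (real (card (X m)) * s n)"
    using s_pos[of n] by (simp add: emeasure_translate emeasure_Q ennreal_mult' ennreal_of_nat_eq_real_of_nat)
  finally show ?thesis .
qed

text \<open>The hypotheses on \<open>p\<close> and \<open>C\<close> are shown to be contradictory.\<close>

context
  fixes p C :: real
  assumes p: "1 < p" and bounded: "convolution_bounded p C" and C: "0 < C"
    and large: "2 powr p * C \<le> s 0 powr (p - 1)"
begin

text \<open>The bound is tested on the indicators of \<open>K\<close> and \<open>Q (Suc m)\<close>,
  whose convolution is at least \<open>s 0\<close> on \<open>Q m\<close> by symmetry of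
  \<open>K\<close>. The hypothesis \<open>large\<close> turns the result into growth by
  \<open>2 powr p\<close>.\<close>

lemma s_growth: "2 powr p * s m \<le> s (Suc m)"
proof -
  have p_eq: "(\<integral>\<^sup>+x. ennreal (indicat_real (Q n) x powr p) \<partial>\<mu>) = ennreal (s n)" for n
  proof -
    have "(\<integral>\<^sup>+x. ennreal (indicat_real (Q n) x powr p) \<partial>\<mu>) = (\<integral>\<^sup>+x. indicator (Q n) x \<partial>\<mu>)"
      by (intro nn_integral_cong) (auto simp: indicator_def)
    then show ?thesis by (simp add: emeasure_Q)
  qed
  have conv: "ennreal (s 0 * indicat_real (Q m) x)
      \<le> (\<integral>\<^sup>+y. ennreal (indicat_real (Q 0) y * indicat_real (Q (Suc m)) (- y + x)) \<partial>\<mu>)" for x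
  proof (cases "x \<in> Q m")
    case True
    have "(\<integral>\<^sup>+y. indicator (Q 0) y \<partial>\<mu>)
        \<le> (\<integral>\<^sup>+y. ennreal (indicat_real (Q 0) y * indicat_real (Q (Suc m)) (- y + x)) \<partial>\<mu>)"
    proof (intro nn_integral_mono)
      fix y
      have "- y + x \<in> Q (Suc m)" if "y \<in> K"
      proof -
        have "- y \<in> K" using that sym_K by blast
        then show ?thesis using True by (auto intro: set_plus_intro)
      qed
      then show "indicator (Q 0) y \<le> ennreal (indicat_real (Q 0) y * indicat_real (Q (Suc m)) (- y + x))"
        by (auto simp: indicator_def)
    qed
    moreover have "(\<integral>\<^sup>+y. indicator (Q 0) y \<partial>\<mu>) = ennreal (s 0)"
      unfolding emeasure_Q[symmetric] by (rule nn_integral_indicator) (simp del: Q.simps)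
    ultimately show ?thesis using True by simp
  qed simp
  have "(\<integral>\<^sup>+x. ennreal ((s 0 * indicat_real (Q m) x) powr p) \<partial>\<mu>)
      \<le> ennreal C * ((\<integral>\<^sup>+x. ennreal (indicat_real (Q 0) x powr p) \<partial>\<mu>)
        * (\<integral>\<^sup>+x. ennreal (indicat_real (Q (Suc m)) x powr p) \<partial>\<mu>))"
    using s_pos[of 0]
    by (intro bounded[unfolded convolution_bounded_def, rule_format] conv) (auto simp: p_eq simp del: Q.simps)
  also have "\<dots> = ennreal (C * (s 0 * s (Suc m)))"
    using C s_pos[of 0] s_pos[of "Suc m"] unfolding p_eq by (simp add: ennreal_mult')
  also have "(\<integral>\<^sup>+x. ennreal ((s 0 * indicat_real (Q m) x) powr p) \<partial>\<mu>)
      = (\<integral>\<^sup>+x. ennreal (s 0 powr p) * ennreal (indicat_real (Q m) x powr p) \<partial>\<mu>)"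
    using s_pos[of 0] by (simp add: powr_mult ennreal_mult')
  also have "\<dots> = ennreal (s 0 powr p * s m)"
    using s_pos[of m] by (subst nn_integral_cmult) (auto simp: p_eq ennreal_mult')
  finally have "s 0 powr p * s m \<le> C * (s 0 * s (Suc m))"
    using C s_pos[of 0] s_pos[of "Suc m"] by (subst (asm) ennreal_le_iff) auto
  moreover have "s 0 powr p = s 0 powr (p - 1) * s 0"
    using s_pos[of 0] by (simp add: powr_diff)
  ultimately have "s 0 * (s 0 powr (p - 1) * s m) \<le> s 0 * (C * s (Suc m))"
    by (simp add: ac_simps)
  then have "s 0 powr (p - 1) * s m \<le> C * s (Suc m)"
    using s_pos[of 0] by simp
  moreover have "2 powr p * C * s m \<le> s 0 powr (p - 1) * s m"
    using large s_pos[of m] by (intro mult_right_mono) auto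
  ultimately have "C * (2 powr p * s m) \<le> C * s (Suc m)" by (simp add: ac_simps)
  then show ?thesis using C by simp
qed

section \<open>The lacunary sum of normalized indicators\<close>

definition c :: "nat \<Rightarrow> real" where "c m = s (Suc m) powr (- 1 / p)"

lemma c_pos: "0 < c m"
  using s_pos[of "Suc m"] by (simp add: c_def)

text \<open>Thus \<open>c m\<close> times the indicator of \<open>Q (Suc m)\<close> has p-th power
  integral 1. The index \<open>Suc m\<close> is the one that occurs in
  \<open>convolution_indicator_ge\<close>.\<close>

lemma c_powr: "c m powr p = 1 / s (Suc m)"
  using p s_pos[of "Suc m"] by (simp add: c_def powr_powr powr_neg_one)

lemma c_halving: "c (Suc m) \<le> c m / 2"
proof -
  have "c (Suc m) \<le> (2 powr p * s (Suc m)) powr (- 1 / p)"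
    unfolding c_def using p s_pos s_growth[of "Suc m"] by (intro powr_mono2') auto
  also have "\<dots> = c m / 2"
    using p s_pos[of "Suc m"] by (simp add: c_def powr_mult powr_powr powr_minus field_simps)
  finally show ?thesis .
qed

definition f :: "nat \<Rightarrow> 'a \<Rightarrow> real" where "f N x = (\<Sum>m<N. c m * indicat_real (Q (Suc m)) x)"

lemma f_borel [measurable]: "f N \<in> borel_measurable borel"
  unfolding f_def by measurable

text \<open>By lacunarity the p-th power of the sum costs only a factor \<open>2 powr p\<close> over
  the sum of the p-th powers, and each of the \<open>N\<close> normalized terms has integral
  1.\<close>

lemma nn_integral_f_powr_le: "(\<integral>\<^sup>+x. ennreal (f N x powr p) \<partial>\<mu>) \<le> ennreal (2 powr p * real N)"
proof -
  have "f N x powr p \<le> 2 powr p * (\<Sum>m<N. c m powr p * indicat_real (Q (Suc m)) x)" for x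
    \<comment> \<open>For fixed \<open>x\<close>, \<open>S\<close> is the set of indices whose term
      is nonzero at \<open>x\<close>.\<close>
    using lacunary_sum_powr_le[where p = p and a = c and N = N and S = "{m. x \<in> Q (Suc m)}"] p less_imp_le[OF c_pos] c_halving
    by (simp add: f_def indicator_def)
  then have "(\<integral>\<^sup>+x. ennreal (f N x powr p) \<partial>\<mu>)
      \<le> (\<integral>\<^sup>+x. ennreal (2 powr p * (\<Sum>m<N. c m powr p * indicat_real (Q (Suc m)) x)) \<partial>\<mu>)"
    by (intro nn_integral_mono ennreal_leI)
  also have "\<dots> = (\<integral>\<^sup>+x. ennreal (2 powr p) * (\<Sum>m<N. ennreal (c m powr p) * indicator (Q (Suc m)) x) \<partial>\<mu>)"
  proof (rule nn_integral_cong)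
    fix x
    have "ennreal (\<Sum>m<N. c m powr p * indicat_real (Q (Suc m)) x)
        = (\<Sum>m<N. ennreal (c m powr p * indicat_real (Q (Suc m)) x))"
      by (rule sum_ennreal[symmetric]) simp
    also have "\<dots> = (\<Sum>m<N. ennreal (c m powr p) * indicator (Q (Suc m)) x)"
      by (intro sum.cong refl) (simp add: ennreal_mult' ennreal_indicator del: Q.simps)
    finally show "ennreal (2 powr p * (\<Sum>m<N. c m powr p * indicat_real (Q (Suc m)) x))
        = ennreal (2 powr p) * (\<Sum>m<N. ennreal (c m powr p) * indicator (Q (Suc m)) x)"
      by (simp add: ennreal_mult' del: Q.simps)
  qed
  also have "\<dots> = ennreal (2 powr p) * (\<integral>\<^sup>+x. (\<Sum>m<N. ennreal (c m powr p) * indicator (Q (Suc m)) x) \<partial>\<mu>)"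
    by (rule nn_integral_cmult) measurable
  also have "(\<integral>\<^sup>+x. (\<Sum>m<N. ennreal (c m powr p) * indicator (Q (Suc m)) x) \<partial>\<mu>)
      = (\<Sum>m<N. ennreal (c m powr p) * emeasure \<mu> (Q (Suc m)))"
  proof -
    have "(\<integral>\<^sup>+x. (\<Sum>m<N. ennreal (c m powr p) * indicator (Q (Suc m)) x) \<partial>\<mu>)
        = (\<Sum>m<N. \<integral>\<^sup>+x. ennreal (c m powr p) * indicator (Q (Suc m)) x \<partial>\<mu>)"
      by (rule nn_integral_sum) measurable
    also have "\<dots> = (\<Sum>m<N. ennreal (c m powr p) * emeasure \<mu> (Q (Suc m)))"
      by (intro sum.cong refl nn_integral_cmult_indicator) (simp del: Q.simps)
    finally show ?thesis .
  qed
  also have "(\<Sum>m<N. ennreal (c m powr p) * emeasure \<mu> (Q (Suc m))) = (\<Sum>m<N. 1)"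
  proof (intro sum.cong refl)
    fix m
    show "ennreal (c m powr p) * emeasure \<mu> (Q (Suc m)) = 1"
      using s_pos[of "Suc m"] unfolding emeasure_Q c_powr by (simp add: ennreal_mult'[symmetric])
  qed
  also have "ennreal (2 powr p) * (\<Sum>m<N. 1) = ennreal (2 powr p * real N)"
    by (simp add: ennreal_mult' ennreal_of_nat_eq_real_of_nat)
  finally show ?thesis .
qed

section \<open>Lower bounds for the self-convolution of \<open>f N\<close>\<close>

definition w :: "nat \<Rightarrow> nat \<Rightarrow> 'a \<Rightarrow> real" where
  "w m n z = c m * c n * measure \<mu> V * (\<Sum>x\<in>X m. indicator ((+) x ` Q n) z)"

lemma w_nonneg: "0 \<le> w m n z"
  using less_imp_le[OF c_pos] by (auto simp: w_def intro!: mult_nonneg_nonneg sum_nonneg)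

lemma w_borel [measurable]: "w m n \<in> borel_measurable borel"
proof -
  have [measurable]: "(+) x ` Q n \<in> sets borel" for x
    by (rule borel_translate[OF Q_borel])
  show ?thesis unfolding w_def by measurable
qed

text \<open>The support is controlled by \<open>m + n\<close> alone, which is why the terms are
  grouped by \<open>j = m + n\<close> later.\<close>

lemma w_eq_0: "z \<notin> Q (Suc (m + n)) \<Longrightarrow> w m n z = 0"
proof -
  assume "z \<notin> Q (Suc (m + n))"
  then have "z \<notin> Q m + Q n" by (simp only: Q_plus_Q) simp
  then have "z \<notin> (+) x ` Q n" if "x \<in> X m" for x
    using that packing_X(2)[of m] by (auto intro: set_plus_intro)
  then show ?thesis by (simp add: w_def)
qed

text \<open>The convolution expands into a double sum over \<open>m, n < N\<close>. Each term
  dominates \<open>w m n\<close>, and only the triangle \<open>m + n < N\<close> is kept.\<close>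

lemma sum_w_le_convolution:
  "ennreal (\<Sum>j<N. \<Sum>m\<le>j. w m (j - m) z) \<le> (\<integral>\<^sup>+y. ennreal (f N y * f N (- y + z)) \<partial>\<mu>)"
proof -
  have [measurable]: "(\<lambda>y. indicator (Q n) (- y + z) :: ennreal) \<in> borel_measurable borel" for n
    using measurable_compose[OF measurable_diff_left, of "indicator (Q n)" borel z] by simp
  have "(\<Sum>j<N. \<Sum>m\<le>j. w m (j - m) z) = (\<Sum>(m, n)\<in>{(m, n). m + n < N}. w m n z)"
    by (rule sum.triangle_reindex[symmetric])
  also have "\<dots> \<le> (\<Sum>(m, n)\<in>{..<N} \<times> {..<N}. w m n z)"
    using w_nonneg by (intro sum_mono2) auto
  finally have "ennreal (\<Sum>j<N. \<Sum>m\<le>j. w m (j - m) z) \<le> ennreal (\<Sum>(m, n)\<in>{..<N} \<times> {..<N}. w m n z)"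
    by (rule ennreal_leI)
  also have "\<dots> = (\<Sum>(m, n)\<in>{..<N} \<times> {..<N}. ennreal (w m n z))"
    using w_nonneg by (subst sum_ennreal[symmetric]) (auto simp: case_prod_beta)
  also have "\<dots> \<le> (\<Sum>(m, n)\<in>{..<N} \<times> {..<N}. ennreal (c m * c n) *
      (\<integral>\<^sup>+y. indicator (Q (Suc m)) y * indicator (Q (Suc n)) (- y + z) \<partial>\<mu>))"
  proof (intro sum_mono, clarify)
    fix m n
    have "ennreal (w m n z) = ennreal (c m * c n) * ennreal (measure \<mu> V * (\<Sum>x\<in>X m. indicator ((+) x ` Q n) z))"
      using c_pos[of m] c_pos[of n] by (simp add: w_def ennreal_mult'[symmetric] mult.assoc)
    then show "ennreal (w m n z) \<le> ennreal (c m * c n) *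
        (\<integral>\<^sup>+y. indicator (Q (Suc m)) y * indicator (Q (Suc n)) (- y + z) \<partial>\<mu>)"
      using mult_left_mono[OF convolution_indicator_ge] by simp
  qed
  also have "\<dots> = (\<integral>\<^sup>+y. (\<Sum>(m, n)\<in>{..<N} \<times> {..<N}. ennreal (c m * c n) *
      (indicator (Q (Suc m)) y * indicator (Q (Suc n)) (- y + z))) \<partial>\<mu>)"
    by (simp add: case_prod_beta nn_integral_sum nn_integral_cmult del: Q.simps)
  also have "\<dots> = (\<integral>\<^sup>+y. ennreal (f N y * f N (- y + z)) \<partial>\<mu>)"
  proof (rule nn_integral_cong)
    fix y
    have "f N y * f N (- y + z) = (\<Sum>(m, n)\<in>{..<N} \<times> {..<N}. (c m * c n) *
        (indicat_real (Q (Suc m)) y * indicat_real (Q (Suc n)) (- y + z)))"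
      unfolding f_def sum_product sum.cartesian_product by (simp add: ac_simps del: Q.simps)
    also have "ennreal \<dots> = (\<Sum>(m, n)\<in>{..<N} \<times> {..<N}. ennreal (c m * c n) *
        (indicator (Q (Suc m)) y * indicator (Q (Suc n)) (- y + z)))"
      using less_imp_le[OF c_pos]
      by (subst sum_ennreal[symmetric])
        (auto simp: case_prod_beta ennreal_mult' ennreal_indicator indicator_def simp del: Q.simps intro!: sum.cong)
    finally show "(\<Sum>(m, n)\<in>{..<N} \<times> {..<N}. ennreal (c m * c n) *
        (indicator (Q (Suc m)) y * indicator (Q (Suc n)) (- y + z))) = ennreal (f N y * f N (- y + z))"
      by simp
  qed
  finally show ?thesis .
qed

lemma nn_integral_w:
  "(\<integral>\<^sup>+z. ennreal (w m n z) \<partial>\<mu>) = ennreal (c m * c n * measure \<mu> V * (real (card (X m)) * s n))"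
proof -
  have [measurable]: "(+) x ` Q n \<in> sets borel" for x
    by (rule borel_translate[OF Q_borel])
  have "(\<integral>\<^sup>+z. ennreal (w m n z) \<partial>\<mu>) =
      (\<integral>\<^sup>+z. ennreal (c m * c n * measure \<mu> V) * ennreal (\<Sum>x\<in>X m. indicator ((+) x ` Q n) z) \<partial>\<mu>)"
    using c_pos[of m] c_pos[of n] by (simp add: w_def ennreal_mult')
  also have "\<dots> = ennreal (c m * c n * measure \<mu> V) * ennreal (real (card (X m)) * s n)"
    by (subst nn_integral_cmult) (auto simp: nn_integral_sum_indicator)
  finally show ?thesis
    using c_pos[of m] c_pos[of n] s_pos[of n] by (simp add: ennreal_mult')
qed

text \<open>Let \<open>r = card (X m) * s n\<close>. Doubling and the packing bounds make
  \<open>s (Suc m) * s (Suc n)\<close> at most a multiple of \<open>r\<close>, so the integral is at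
  least a multiple of \<open>r powr (1 - 1 / p)\<close>; and \<open>r\<close> is at least a multiple
  of \<open>s (Suc (m + n))\<close>.\<close>

lemma nn_integral_w_ge:
  "\<exists>b>0. \<forall>m n. b * s (Suc (m + n)) powr (1 - 1 / p) \<le> c m * c n * measure \<mu> V * (real (card (X m)) * s n)"
proof -
  obtain D where D: "0 < D" "\<And>m. s (Suc m) \<le> D * s m"
    using s_doubling by blast
  define b where "b = measure \<mu> V * (D * D * s 0) powr (- 1 / p) * D powr (1 / p - 1)"
  have "b * s (Suc (m + n)) powr (1 - 1 / p) \<le> c m * c n * measure \<mu> V * (real (card (X m)) * s n)" for m n
  proof -
    define r where "r = real (card (X m)) * s n"
    have p_inv: "0 \<le> 1 / p" "1 / p \<le> 1" using p by auto
    have 1: "s (Suc (m + n)) \<le> D * r"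
    proof -
      have "real (card (X m)) * s (Suc n) \<le> real (card (X m)) * (D * s n)"
        using D(2) by (intro mult_left_mono) auto
      then show ?thesis using s_add_le_card[of m n] by (simp add: r_def ac_simps)
    qed
    have 2: "s (Suc m) * s (Suc n) \<le> D * D * s 0 * r"
    proof -
      have "s (Suc m) * s (Suc n) \<le> (D * s m) * (D * s n)"
        using D s_pos less_imp_le by (intro mult_mono) (auto simp: less_imp_le)
      also have "\<dots> \<le> (D * (real (card (X m)) * s 0)) * (D * s n)"
        using D s_le_card[of m] s_pos[of n] by (intro mult_right_mono mult_left_mono) auto
      finally show ?thesis by (simp add: r_def ac_simps)
    qed
    have r: "0 < r"
      using less_le_trans[OF s_pos 1] D(1) by (simp add: zero_less_mult_iff)
    have "(D * D * s 0 * r) powr (- 1 / p) \<le> (s (Suc m) * s (Suc n)) powr (- 1 / p)"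
      using 2 s_pos p by (intro powr_mono2') auto
    then have cc: "(D * D * s 0) powr (- 1 / p) * r powr (- 1 / p) \<le> c m * c n"
      using D(1) s_pos r by (simp add: c_def powr_mult less_imp_le)
    have rr: "D powr (1 / p - 1) * s (Suc (m + n)) powr (1 - 1 / p) \<le> r powr (1 - 1 / p)"
    proof -
      have "s (Suc (m + n)) powr (1 - 1 / p) \<le> (D * r) powr (1 - 1 / p)"
        using 1 p_inv s_pos less_imp_le by (intro powr_mono2) (auto simp: less_imp_le)
      also have "\<dots> = D powr (1 - 1 / p) * r powr (1 - 1 / p)"
        using D(1) r by (simp add: powr_mult)
      finally have "D powr (1 / p - 1) * s (Suc (m + n)) powr (1 - 1 / p)
          \<le> D powr (1 / p - 1) * (D powr (1 - 1 / p) * r powr (1 - 1 / p))"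
        by (intro mult_left_mono) auto
      also have "\<dots> = r powr (1 - 1 / p)"
        using D(1) by (simp add: mult.assoc[symmetric] powr_add[symmetric])
      finally show ?thesis .
    qed
    have "b * s (Suc (m + n)) powr (1 - 1 / p)
        = measure \<mu> V * (D * D * s 0) powr (- 1 / p) * (D powr (1 / p - 1) * s (Suc (m + n)) powr (1 - 1 / p))"
      by (simp add: b_def)
    also have "\<dots> \<le> measure \<mu> V * (D * D * s 0) powr (- 1 / p) * r powr (1 - 1 / p)"
      by (intro mult_left_mono rr) auto
    also have "\<dots> = measure \<mu> V * ((D * D * s 0) powr (- 1 / p) * r powr (- 1 / p)) * r"
      using r by (simp add: powr_diff powr_minus field_simps)
    also have "\<dots> \<le> measure \<mu> V * (c m * c n) * r"
      using r by (intro mult_left_mono mult_right_mono cc) auto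
    finally show ?thesis by (simp add: r_def ac_simps)
  qed
  moreover have "0 < b"
    using D(1) s_pos[of 0] measure_V_pos by (simp add: b_def)
  ultimately show ?thesis by blast
qed

lemma convolution_not_bounded: False
proof -
  obtain b where b: "0 < b"
    "\<And>m n. b * s (Suc (m + n)) powr (1 - 1 / p) \<le> c m * c n * measure \<mu> V * (real (card (X m)) * s n)"
    using nn_integral_w_ge by blast
  define W where "W j z = (\<Sum>m\<le>j. w m (j - m) z)" for j z
  have W_nonneg: "0 \<le> W j z" for j z
    unfolding W_def by (intro sum_nonneg w_nonneg)
  have W_borel[measurable]: "W j \<in> borel_measurable borel" for j
    unfolding W_def by measurable
  \<comment> \<open>\<open>W j\<close> lives on \<open>Q (Suc j)\<close> and consists of
    \<open>j + 1\<close> terms. In Jensen's inequality the powers of \<open>S\<close> cancel, so the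
    bound depends on \<open>j\<close> alone.\<close>
  have level: "ennreal ((real (Suc j) * b) powr p) \<le> (\<integral>\<^sup>+z. ennreal (W j z powr p) \<partial>\<mu>)" for j
  proof -
    define I where "I = (\<Sum>m\<le>j. c m * c (j - m) * measure \<mu> V * (real (card (X m)) * s (j - m)))"
    define S where "S = s (Suc j)"
    have S: "0 < S" unfolding S_def by (rule s_pos)
    have "(\<integral>\<^sup>+z. ennreal (W j z) \<partial>\<mu>) = (\<integral>\<^sup>+z. (\<Sum>m\<le>j. ennreal (w m (j - m) z)) \<partial>\<mu>)"
      unfolding W_def using w_nonneg by (simp add: sum_ennreal)
    also have "\<dots> = (\<Sum>m\<le>j. \<integral>\<^sup>+z. ennreal (w m (j - m) z) \<partial>\<mu>)"
      by (rule nn_integral_sum) measurable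
    also have "\<dots> = ennreal I"
      unfolding I_def nn_integral_w using c_pos s_pos
      by (intro sum_ennreal) (simp add: less_imp_le)
    finally have int_W: "(\<integral>\<^sup>+z. ennreal (W j z) \<partial>\<mu>) = ennreal I" .
    have "(\<Sum>m\<le>j. b * S powr (1 - 1 / p)) \<le> I"
      unfolding I_def S_def
    proof (rule sum_mono)
      fix m assume "m \<in> {..j}"
      then show "b * s (Suc j) powr (1 - 1 / p) \<le> c m * c (j - m) * measure \<mu> V * (real (card (X m)) * s (j - m))"
        using b(2)[of m "j - m"] by simp
    qed
    then have I_ge: "real (Suc j) * b * S powr (1 - 1 / p) \<le> I" by simp
    have I_nonneg: "0 \<le> I"
      using I_ge b(1) by (intro order_trans[OF _ I_ge]) auto
    have "(real (Suc j) * b) powr p = S powr (1 - p) * (real (Suc j) * b * S powr (1 - 1 / p)) powr p"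
    proof -
      have exponent: "(1 - 1 / p) * p = p - 1"
        using p by (simp add: field_simps)
      have "(real (Suc j) * b * S powr (1 - 1 / p)) powr p = (real (Suc j) * b) powr p * S powr (p - 1)"
        using b(1) exponent by (simp add: powr_mult powr_powr del: of_nat_Suc)
      then show ?thesis
        using S by (simp add: powr_add[symmetric] mult.left_commute)
    qed
    also have "\<dots> \<le> S powr (1 - p) * I powr p"
      using I_ge p b(1) by (intro mult_left_mono powr_mono2) auto
    finally have "ennreal ((real (Suc j) * b) powr p) \<le> ennreal (S powr (1 - p) * I powr p)"
      by (rule ennreal_leI)
    also have "\<dots> \<le> (\<integral>\<^sup>+z. ennreal (W j z powr p) \<partial>\<mu>)"
      unfolding S_def s_def
    proof (rule powr_nn_integral_le[OF p _ W_nonneg _ _ _ _ int_W I_nonneg])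
      show "0 < measure \<mu> (Q (Suc j))"
        using s_pos[of "Suc j"] by (simp only: s_def)
      show "W j x = 0" if "x \<in> space \<mu> - Q (Suc j)" for x
        unfolding W_def using that by (intro sum.neutral ballI w_eq_0) auto
    qed (auto simp: emeasure_Q simp del: Q.simps)
    finally show ?thesis .
  qed
  have main: "(\<Sum>j<N. (real (Suc j) * b) powr p) \<le> C * (2 powr p * real N)\<^sup>2" for N
  proof -
    have "ennreal (\<Sum>j<N. (real (Suc j) * b) powr p) = (\<Sum>j<N. ennreal ((real (Suc j) * b) powr p))"
      by (simp add: sum_ennreal)
    also have "\<dots> \<le> (\<Sum>j<N. \<integral>\<^sup>+z. ennreal (W j z powr p) \<partial>\<mu>)"
      by (intro sum_mono level)
    also have "\<dots> = (\<integral>\<^sup>+z. (\<Sum>j<N. ennreal (W j z powr p)) \<partial>\<mu>)"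
      by (rule nn_integral_sum[symmetric]) measurable
    also have "\<dots> \<le> (\<integral>\<^sup>+z. ennreal ((\<Sum>j<N. W j z) powr p) \<partial>\<mu>)"
      using p W_nonneg by (intro nn_integral_mono) (simp add: sum_ennreal ennreal_leI sum_powr_le_powr_sum)
    also have "\<dots> \<le> ennreal C * ((\<integral>\<^sup>+x. ennreal (f N x powr p) \<partial>\<mu>) * (\<integral>\<^sup>+x. ennreal (f N x powr p) \<partial>\<mu>))"
    proof (intro bounded[unfolded convolution_bounded_def, rule_format])
      show "ennreal (\<Sum>j<N. W j x) \<le> (\<integral>\<^sup>+y. ennreal (f N y * f N (- y + x)) \<partial>\<mu>)" for x
        unfolding W_def by (rule sum_w_le_convolution)
      show "0 \<le> f N x \<and> 0 \<le> f N x \<and> 0 \<le> (\<Sum>j<N. W j x)" for x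
        using W_nonneg less_imp_le[OF c_pos] by (auto simp: f_def intro!: sum_nonneg)
      show "(\<integral>\<^sup>+x. ennreal (f N x powr p) \<partial>\<mu>) < \<infinity>"
        by (rule le_less_trans[OF nn_integral_f_powr_le]) simp
      then show "(\<integral>\<^sup>+x. ennreal (f N x powr p) \<partial>\<mu>) < \<infinity>" .
    qed measurable
    also have "\<dots> \<le> ennreal C * (ennreal (2 powr p * real N) * ennreal (2 powr p * real N))"
      by (intro mult_left_mono mult_mono nn_integral_f_powr_le) auto
    also have "\<dots> = ennreal (C * (2 powr p * real N)\<^sup>2)"
      using C by (simp add: ennreal_mult'[symmetric] power2_eq_square)
    finally show ?thesis
      using C by (subst (asm) ennreal_le_iff) auto
  qed
  \<comment> \<open>\<open>main\<close> is applied with \<open>N = 2 * k\<close>: the upper half of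
    the sum has \<open>k\<close> terms, each at least \<open>(k * b) powr p\<close>, and dividing by
    \<open>k\<^sup>2\<close> leaves \<open>k powr (p - 1) \<le> B\<close>.\<close>
  define B where "B = 4 * C * (2 powr p)\<^sup>2 / b powr p"
  have bound: "real k powr (p - 1) \<le> B" if k: "0 < k" for k
  proof -
    have "real k * (real k * b) powr p = (\<Sum>j\<in>{k..<2 * k}. (real k * b) powr p)" by simp
    also have "\<dots> \<le> (\<Sum>j\<in>{k..<2 * k}. (real (Suc j) * b) powr p)"
      using p b(1) by (intro sum_mono powr_mono2 mult_right_mono) auto
    also have "\<dots> \<le> (\<Sum>j<2 * k. (real (Suc j) * b) powr p)"
      by (intro sum_mono2) auto
    also have "\<dots> \<le> C * (2 powr p * real (2 * k))\<^sup>2"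
      by (rule main)
    finally have "real k * (real k * (real k powr (p - 1) * b powr p)) \<le> real k * (real k * (4 * C * (2 powr p)\<^sup>2))"
      using k b(1) by (simp add: powr_mult powr_diff power2_eq_square ac_simps)
    then show ?thesis
      using k b(1) by (simp add: B_def field_simps)
  qed
  \<comment> \<open>Chosen so that \<open>t powr (p - 1) = \<bar>B\<bar> + 1\<close>, which exceeds
    \<open>B\<close>.\<close>
  define t where "t = (\<bar>B\<bar> + 1) powr (1 / (p - 1))"
  obtain k where k: "t < real k" using reals_Archimedean2 by blast
  have "0 < t" by (simp add: t_def)
  have "B < t powr (p - 1)" using p by (simp add: t_def powr_powr)
  also have "\<dots> \<le> real k powr (p - 1)"
    using k p \<open>0 < t\<close> by (intro powr_mono2) auto
  finally show False
    using bound[of k] k \<open>0 < t\<close> by auto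
qed

end

end

text \<open>A non-compact group has infinite measure, so inner regularity supplies a compact set
  large enough to start the argument with powers of \<open>K\<close>.\<close>

lemma (in left_haar) convolution_bounded_imp_compact:
  assumes p: "1 < p" and bounded: "convolution_bounded p C" and C: "0 < C"
    and lc: "locally_compact_space (euclidean :: 'g topology)"
  shows "compact (UNIV :: 'g set)"
proof (rule ccontr)
  assume nc: "\<not> compact (UNIV :: 'g set)"
  obtain U L :: "'g set" where UL: "open U" "compact L" "0 \<in> U" "U \<subseteq> L"
  proof -
    have "\<forall>x::'g. \<exists>U. open U \<and> (\<exists>L. compact L \<and> x \<in> U \<and> U \<subseteq> L)"
      using lc by (simp add: locally_compact_space_def)
    then show ?thesis using that by blast
  qed
  have sym: "uminus ` (A \<union> uminus ` A) = A \<union> uminus ` A" for A :: "'g set"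
    by (auto simp: image_Un image_image)
  have compact_uminus: "compact (uminus ` A)" if "compact A" for A :: "'g set"
    using that by (intro compact_continuous_image continuous_intros)
  define V where "V = L \<union> uminus ` L"
  have V: "compact V" "uminus ` V = V" "U \<subseteq> V"
    using UL compact_uminus by (auto simp: V_def sym)
  have "emeasure \<mu> UNIV = \<infinity>"
    using compact_if_finite_measure[OF V(1,2) UL(1,3) V(3)] nc by (auto simp: less_top[symmetric])
  then have inf: "(SUP K\<in>{K. compact K \<and> K \<subseteq> UNIV}. emeasure \<mu> K) = \<infinity>"
    using inner_regular[of UNIV] by simp
  \<comment> \<open>The threshold for \<open>s 0\<close> at which \<open>large\<close> holds:
    \<open>t powr (p - 1) = 2 powr p * C\<close>.\<close>
  define t where "t = (2 powr p * C) powr (1 / (p - 1))"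
  have "ennreal t < (SUP K\<in>{K. compact K \<and> K \<subseteq> UNIV}. emeasure \<mu> K)"
    unfolding inf by simp
  then obtain M where M: "compact M" "ennreal t < emeasure \<mu> M"
    by (auto simp: less_SUP_iff)
  \<comment> \<open>\<open>V + V\<close> is needed for the packings and \<open>M\<close> for the
    size; the union is then symmetrized.\<close>
  define K where "K = (V + V \<union> M) \<union> uminus ` (V + V \<union> M)"
  have "compact (V + V \<union> M)"
    using V M by (intro compact_Un compact_set_plus)
  then have K: "compact K" "uminus ` K = K" "V + V \<subseteq> K" "M \<subseteq> K"
    using compact_uminus by (auto simp: K_def sym)
  interpret haar_neighborhoods \<mu> V K U
    by standard (use V K UL in auto)
  have "ennreal t < ennreal (s 0)"
    using M K compact_borel unfolding emeasure_Q[symmetric]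
    by (intro less_le_trans[OF M(2)] emeasure_mono) auto
  then have "t < s 0" by (simp add: ennreal_less_iff t_def)
  then have "t powr (p - 1) \<le> s 0 powr (p - 1)"
    using p by (intro powr_mono2) (auto simp: t_def)
  moreover have "t powr (p - 1) = 2 powr p * C"
    using p C by (simp add: t_def powr_powr)
  ultimately show False
    using convolution_not_bounded[OF p bounded C] by simp
qed

theorem theorem2p1:
  fixes \<mu> :: "'g::{topological_group_add, t2_space} measure"
    and p :: real
  assumes "(characters :: ('a::separable_complex_banach_algebra \<Rightarrow> complex) set) \<noteq> {}"
    and "locally_compact_space (euclidean :: 'g topology)"
    and "normalized_left_Haar_measure \<mu>"
    and "1 < p"
  shows "Lp_is_banach_algebra TYPE('a) \<mu> p \<longleftrightarrow> compact (UNIV :: 'g set)"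
proof
  interpret left_haar \<mu>
    using assms(3) by unfold_locales (simp add: normalized_left_Haar_measure_def)
  {
    assume alg: "Lp_is_banach_algebra TYPE('a) \<mu> p"
    obtain a :: 'a where a: "a * a \<noteq> 0"
      using character_imp_square_nonzero[OF assms(1)] by blast
    \<comment> \<open>Both \<open>norm a\<close> and \<open>norm (a * a)\<close> are nonzero, so the
      constant of the scalar inequality is positive.\<close>
    then have "a \<noteq> 0" by auto
    then show "compact (UNIV :: 'g set)"
      using convolution_bounded_imp_compact[OF assms(4)
          Lp_is_banach_algebra_imp_convolution_bounded[OF alg a assms(4)] _ assms(2)] a
      by simp
  next
    assume compact: "compact (UNIV :: 'g set)"
    interpret compact_haar \<mu>
      using assms(3) compact by unfold_locales (auto simp: normalized_left_Haar_measure_def)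
    show "Lp_is_banach_algebra TYPE('a) \<mu> p"
      using assms(4) by (rule Lp_is_banach_algebra)
  }
qed

end
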